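(* Let $\ell\ge0$ be an integer and let $\Lambda=(\ell-1)\Lambda_0+\Lambda_i$ be a distinguished representative of level $\ell$ (with $\ell\ge1$ if $i\ne0$). Then the number of dominant maximal weights of $V(\Lambda)$ is: - for $B_n^{(1)}$, $i\in\{0,n\}$: $\displaystyle |\max{}^+(\Lambda)|=\binom{n+\lfloor\frac{\ell-\delta_{in}}2\rfloor}{n}+\binom{n+\lfloor\frac{\ell-1-\delta_{in}}2\rfloor}{n}$; - for $C_n^{(1)}$, $i\in\{0,1\}$: $\displaystyle |\max{}^+(\Lambda)|=\frac12\left(\binom{n+\ell}{n}+(-1)^i\,\delta(n\ell\equiv_2 0)\binom{\lfloor\frac{n+\ell}2\rfloor}{\lfloor\frac n2\rfloor}\right)$; - for $A_{2n}^{(2)}$, $i=0$: $\displaystyle |\max{}^+(\Lambda)|=\binom{n+\lfloor\frac\ell2\rfloor}{n}$; - for $D_{n+1}^{(2)}$, $i\in\{0,n\}$: $\displaystyle |\max{}^+(\Lambda)|=\binom{n+\lfloor\frac{\ell-\delta_{in}}2\rfloor}{n}$.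
   Context: $\delta_{in}$ is the Kronecker delta, and $\delta(n\ell\equiv_20)$ is $1$ if $n\ell$ is even and $0$ otherwise; binomial coefficients $\binom{n-1}{n}$ are $0$. For a dominant integral weight $\Lambda$, a weight $\mu$ of the irreducible highest weight module $V(\Lambda)$ is maximal if $\mu+\delta$ is not a weight ($\delta$ the null root), and $\max^+(\Lambda)$ is the set of dominant maximal weights of $V(\Lambda)$. Standard (Kac) labelling with vertices $0,\dots,n$: $n\ge3$ for $B_n^{(1)}$, $n\ge2$ for $C_n^{(1)}$ and $D_{n+1}^{(2)}$, $n\ge1$ for $A_{2n}^{(2)}$; the canonical central element $c=\sum_i a_i^\vee h_i$ has $(a_0^\vee,\dots,a_n^\vee)=(1,1,2,\dots,2,1)$ for $B_n^{(1)}$, $(1,\dots,1)$ for $C_n^{(1)}$, $(1,2,\dots,2)$ for $A_{2n}^{(2)}$, $(1,2,\dots,2,1)$ for $D_{n+1}^{(2)}$. Deleting vertex $0$ leaves $B_n$ for $B_n^{(1)},D_{n+1}^{(2)}$ and $C_n$ for $C_n^{(1)},A_{2n}^{(2)}$ with standard labelling. The distinguished representatives of level $\ell$ are the weights $(\ell-1)\Lambda_0+\Lambda_i$ with $i$ in the indicated set for each type. *)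

theory Defs
  imports Complex_Main
begin

section \<open>Affine Cartan matrices\<close>

text \<open>
  The types \<open>B\<^sub>n\<^sup>(\<^sup>1\<^sup>)\<close>, \<open>C\<^sub>n\<^sup>(\<^sup>1\<^sup>)\<close>,
  \<open>A\<^sub>2\<^sub>n\<^sup>(\<^sup>2\<^sup>)\<close> and \<open>D\<^sub>n\<^sub>+\<^sub>1\<^sup>(\<^sup>2\<^sup>)\<close>, in this order.
\<close>

datatype affine_type = AffB | AffC | TwA | TwD

fun min_rank :: "affine_type \<Rightarrow> nat" where
  "min_rank AffB = 3"
| "min_rank AffC = 2"
| "min_rank TwA = 1"
| "min_rank TwD = 2"

text \<open>
  Kac's convention \<open>a\<^sub>i\<^sub>j = \<langle>h\<^sub>i, \<alpha>\<^sub>j\<rangle>\<close> with his vertex labelling. Entries are meaningful only for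
  \<open>i, j \<le> n\<close> and \<open>min_rank X \<le> n\<close>. The diagrams are
  \<open>AffB\<close>: vertices 0 and 1 both joined to 2, then \<open>2 - \<dots> - (n-1) \<Rightarrow> n\<close>;
  \<open>AffC\<close>: \<open>0 \<Rightarrow> 1 - \<dots> - (n-1) \<Leftarrow> n\<close>;
  \<open>TwA\<close>: \<open>0 \<Leftarrow> 1 - \<dots> - (n-1) \<Leftarrow> n\<close>, which degenerates to a quadruple edge for \<open>n = 1\<close>;
  \<open>TwD\<close>: \<open>0 \<Leftarrow> 1 - \<dots> - (n-1) \<Rightarrow> n\<close>; arrows point to the shorter root.
\<close>

fun affine_cartan :: "affine_type \<Rightarrow> nat \<Rightarrow> nat \<Rightarrow> nat \<Rightarrow> int" where
  "affine_cartan AffB n i j =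
     (if i = j then 2
      else if {i, j} = {0, 1} then 0
      else if {i, j} = {0, 2} then -1
      else if i = n \<and> n = j + 1 then -2
      else if j = i + 1 \<or> i = j + 1 then -1 else 0)"
| "affine_cartan AffC n i j =
     (if i = j then 2
      else if i = 1 \<and> j = 0 then -2
      else if j = n \<and> n = i + 1 then -2
      else if j = i + 1 \<or> i = j + 1 then -1 else 0)"
| "affine_cartan TwA n i j =
     (if i = j then 2
      else if n = 1 \<and> i = 0 \<and> j = 1 then -4
      else if i = 0 \<and> j = 1 then -2
      else if j = n \<and> n = i + 1 then -2
      else if j = i + 1 \<or> i = j + 1 then -1 else 0)"
| "affine_cartan TwD n i j =
     (if i = j then 2
      else if i = 0 \<and> j = 1 then -2
      else if i = n \<and> n = j + 1 then -2
      else if j = i + 1 \<or> i = j + 1 then -1 else 0)"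

text \<open>
  The labels \<open>a\<^sub>0, \<dots>, a\<^sub>n\<close> (the coprime positive integers with \<open>A a = 0\<close>, giving the null root) and
  the dual labels (giving the canonical central element).
\<close>

fun mark :: "affine_type \<Rightarrow> nat \<Rightarrow> nat \<Rightarrow> nat" where
  "mark AffB n i = (if i \<le> 1 then 1 else 2)"
| "mark AffC n i = (if i = 0 \<or> i = n then 1 else 2)"
| "mark TwA n i = (if i = n then 1 else 2)"
| "mark TwD n i = 1"

fun comark :: "affine_type \<Rightarrow> nat \<Rightarrow> nat \<Rightarrow> nat" where
  "comark AffB n i = (if i \<le> 1 \<or> i = n then 1 else 2)"
| "comark AffC n i = 1"
| "comark TwA n i = (if i = 0 then 1 else 2)"
| "comark TwD n i = (if i = 0 \<or> i = n then 1 else 2)"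

lemma sum_restrict:
  fixes g :: "nat \<Rightarrow> int"
  assumes "S \<subseteq> {..n}" and "\<And>j. j \<le> n \<Longrightarrow> j \<notin> S \<Longrightarrow> g j = 0"
  shows "(\<Sum>j\<le>n. g j) = (\<Sum>j\<in>S. g j)"
  using assms by (intro sum.mono_neutral_right) auto

lemma sum_two_terms:
  fixes g :: "nat \<Rightarrow> int"
  assumes "a \<noteq> b" "a \<le> n" "b \<le> n" "\<And>j. j \<le> n \<Longrightarrow> j \<noteq> a \<Longrightarrow> j \<noteq> b \<Longrightarrow> g j = 0" "g a + g b = 0"
  shows "(\<Sum>j\<le>n. g j) = 0"
  using sum_restrict[of "{a, b}" n g] assms by auto

lemma sum_three_terms:
  fixes g :: "nat \<Rightarrow> int"
  assumes "k + 2 \<le> n" "\<And>j. j < k \<Longrightarrow> g j = 0" "\<And>j. k + 2 < j \<Longrightarrow> j \<le> n \<Longrightarrow> g j = 0" "g k + g (k+1) + g (k+2) = 0"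
  shows "(\<Sum>j\<le>n. g j) = 0"
proof -
  have "(\<Sum>j\<le>n. g j) = (\<Sum>j\<in>{k, k+1, k+2}. g j)"
  proof (rule sum_restrict)
    fix j assume "j \<le> n" "j \<notin> {k, k+1, k+2}"
    then have "j < k \<or> k + 2 < j" by auto
    then show "g j = 0" using assms \<open>j \<le> n\<close> by blast
  qed (use assms(1) in auto)
  then show ?thesis using assms(4) by simp
qed

lemma sum_four_terms:
  fixes g :: "nat \<Rightarrow> int"
  assumes "3 \<le> n" "\<And>j. j \<le> n \<Longrightarrow> j > 3 \<Longrightarrow> g j = 0" "g 0 + g 1 + g 2 + g 3 = 0"
  shows "(\<Sum>j\<le>n. g j) = 0"
proof -
  have "(\<Sum>j\<le>n. g j) = (\<Sum>j\<in>{0,1,2,3}. g j)" using assms by (intro sum_restrict) auto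
  then show ?thesis using assms(3) by simp
qed

lemma mark_comark_null:
  assumes n: "min_rank X \<le> n" and i: "i \<le> n"
  shows "(\<Sum>j\<le>n. affine_cartan X n i j * int (mark X n j)) = 0 \<and>
         (\<Sum>j\<le>n. int (comark X n j) * affine_cartan X n j i) = 0"
proof -
  have "n > 0"
    using n by (cases X) auto
  then consider "i = 0" | k where "n = Suc k" "i = Suc k"
    | k m where "i = Suc k" "n = Suc (Suc (k + m))"
    using i by (metis Suc_leI add_Suc gr0_implies_Suc le_Suc_ex le_neq_implies_less not_gr_zero)
  then show ?thesis
  proof cases
    case 1
    with n show ?thesis
      by (cases X; intro conjI sum_two_terms[of 0 "if X = AffB then 2 else 1"])
        (auto simp: doubleton_eq_iff)
  next
    case 2
    with n show ?thesis
      by (cases X; intro conjI sum_two_terms[of k "Suc k"]) (auto simp: doubleton_eq_iff)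
  next
    case 3
    consider "X \<noteq> AffB \<or> k \<ge> 2" | "X = AffB" "k = 0" | "X = AffB" "k = 1"
      by linarith
    then show ?thesis
    proof cases
      case 1
      then show ?thesis
        unfolding 3 by (cases X; intro conjI sum_three_terms[of k]; cases k; cases m)
          (simp_all add: doubleton_eq_iff)
    next
      case 2
      with 3 n show ?thesis
        by (intro conjI; simp only: ; intro sum_two_terms[of 1 2]) (auto simp: doubleton_eq_iff)
    next
      case 3
      with \<open>i = Suc k\<close> \<open>n = Suc (Suc (k + m))\<close> show ?thesis
        by (intro conjI; simp only: ; intro sum_four_terms) (auto simp: doubleton_eq_iff)
    qed
  qed
qed

lemma mark_coprime: "\<exists>i\<le>n. mark X n i = 1"
  by (cases X) auto

text \<open>The indices \<open>i\<close> of the distinguished representatives \<open>(l - 1) \<Lambda>\<^sub>0 + \<Lambda>\<^sub>i\<close>.\<close>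

fun distinguished :: "affine_type \<Rightarrow> nat \<Rightarrow> nat set" where
  "distinguished AffB n = {0, n}"
| "distinguished AffC n = {0, 1}"
| "distinguished TwA n = {0}"
| "distinguished TwD n = {0, n}"


section \<open>Lie algebras and their modules\<close>

locale lie_algebra = vector_space scale
  for scale :: "complex \<Rightarrow> 'g::ab_group_add \<Rightarrow> 'g" +
  fixes bracket :: "'g \<Rightarrow> 'g \<Rightarrow> 'g"
  assumes bracket_linear_right: "Vector_Spaces.linear scale scale (bracket x)"
    and bracket_linear_left: "Vector_Spaces.linear scale scale (\<lambda>x. bracket x y)"
    and bracket_self: "bracket x x = 0"
    and jacobi: "bracket x (bracket y z) + bracket y (bracket z x) + bracket z (bracket x y) = 0"
begin

definition subalgebra :: "'g set \<Rightarrow> bool" where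
  "subalgebra S \<longleftrightarrow> subspace S \<and> (\<forall>x\<in>S. \<forall>y\<in>S. bracket x y \<in> S)"

definition lie_ideal :: "'g set \<Rightarrow> bool" where
  "lie_ideal J \<longleftrightarrow> subspace J \<and> (\<forall>x. \<forall>y\<in>J. bracket x y \<in> J)"

definition generated_subalgebra :: "'g set \<Rightarrow> 'g set" where
  "generated_subalgebra T = \<Inter>{S. subalgebra S \<and> T \<subseteq> S}"

end

locale lie_module = lie_algebra gscale bracket + V: vector_space vscale
  for gscale :: "complex \<Rightarrow> 'g::ab_group_add \<Rightarrow> 'g"
    and bracket :: "'g \<Rightarrow> 'g \<Rightarrow> 'g"
    and vscale :: "complex \<Rightarrow> 'v::ab_group_add \<Rightarrow> 'v" +
  fixes act :: "'g \<Rightarrow> 'v \<Rightarrow> 'v"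
  assumes act_linear_right: "Vector_Spaces.linear vscale vscale (act x)"
    and act_linear_left: "Vector_Spaces.linear gscale vscale (\<lambda>x. act x v)"
    and act_bracket: "act (bracket x y) v = act x (act y v) - act y (act x v)"
begin

definition submodule :: "'v set \<Rightarrow> bool" where
  "submodule W \<longleftrightarrow> V.subspace W \<and> (\<forall>x. \<forall>w\<in>W. act x w \<in> W)"

definition generated_submodule :: "'v set \<Rightarrow> 'v set" where
  "generated_submodule T = \<Inter>{W. submodule W \<and> T \<subseteq> W}"

definition irreducible_module :: bool where
  "irreducible_module \<longleftrightarrow>
     (UNIV :: 'v set) \<noteq> {0} \<and> (\<forall>W. submodule W \<longrightarrow> W = {0} \<or> W = UNIV)"

end


section \<open>Affine Kac-Moody algebras\<close>

text \<open>
  A realization of the Cartan matrix: the type \<open>'h\<close> is the Cartan subalgebra, and elements of its dual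
  are functions \<open>'h \<Rightarrow> complex\<close>. The matrix has size \<open>n + 1\<close> and rank \<open>n\<close>, so a realization has
  dimension \<open>2 (n + 1) - n\<close>.
\<close>

locale affine_realization = H: vector_space hscale
  for hscale :: "complex \<Rightarrow> 'h::ab_group_add \<Rightarrow> 'h" +
  fixes X :: affine_type
    and n :: nat
    and coroot :: "nat \<Rightarrow> 'h"
    and simple_root :: "nat \<Rightarrow> 'h \<Rightarrow> complex"
  assumes rank: "min_rank X \<le> n"
    and dim_cartan: "H.dim (UNIV :: 'h set) = n + 2"
    and simple_root_linear: "i \<le> n \<Longrightarrow> Vector_Spaces.linear hscale (*) (simple_root i)"
    and simple_root_coroot:
      "i \<le> n \<Longrightarrow> j \<le> n \<Longrightarrow> simple_root j (coroot i) = of_int (affine_cartan X n i j)"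
    and coroots_independent:
      "(\<Sum>i\<le>n. hscale (c i) (coroot i)) = 0 \<Longrightarrow> i \<le> n \<Longrightarrow> c i = 0"
    and simple_roots_independent:
      "(\<And>h. (\<Sum>i\<le>n. c i * simple_root i h) = 0) \<Longrightarrow> i \<le> n \<Longrightarrow> c i = 0"
begin

definition null_root :: "'h \<Rightarrow> complex" where
  "null_root h = (\<Sum>i\<le>n. of_nat (mark X n i) * simple_root i h)"

definition fundamental_weights :: "(nat \<Rightarrow> 'h \<Rightarrow> complex) \<Rightarrow> bool" where
  "fundamental_weights \<omega> \<longleftrightarrow>
     (\<forall>i\<le>n. Vector_Spaces.linear hscale (*) (\<omega> i) \<and>
            (\<forall>j\<le>n. \<omega> i (coroot j) = (if i = j then 1 else 0)))"

definition dominant_integral :: "('h \<Rightarrow> complex) \<Rightarrow> bool" where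
  "dominant_integral \<mu> \<longleftrightarrow>
     Vector_Spaces.linear hscale (*) \<mu> \<and> (\<forall>i\<le>n. \<mu> (coroot i) \<in> \<nat>)"

definition central_element :: 'h where
  "central_element = (\<Sum>i\<le>n. hscale (of_nat (comark X n i)) (coroot i))"

lemma distinguished_level:
  assumes "fundamental_weights \<omega>" and i: "i \<in> distinguished X n"
  shows "(of_nat l - 1) * \<omega> 0 central_element + \<omega> i central_element = of_nat l"
proof -
  have *: "\<omega> k central_element = of_nat (comark X n k)" if "k \<le> n" for k
  proof -
    interpret W: Vector_Spaces.linear hscale "(*)" "\<omega> k"
      using assms(1) that by (simp add: fundamental_weights_def)
    have "\<omega> k central_element = (\<Sum>i\<le>n. of_nat (comark X n i) * \<omega> k (coroot i))"
      by (simp only: central_element_def W.sum W.scale)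
    also have "\<dots> = (\<Sum>i\<le>n. if i = k then of_nat (comark X n k) else 0)"
      using assms(1) that by (intro sum.cong) (auto simp: fundamental_weights_def)
    also have "\<dots> = of_nat (comark X n k)"
      using that by simp
    finally show ?thesis .
  qed
  have "comark X n 0 = 1 \<and> comark X n i = 1 \<and> i \<le> n"
    using i rank by (cases X) auto
  then show ?thesis
    using *[of 0] *[of i] by simp
qed

end

text \<open>
  The Kac-Moody algebra of the matrix, pinned down up to isomorphism as in Kac, Proposition 1.4: it
  is generated by the Cartan subalgebra and the Chevalley generators, subject to the Weyl relations,
  and has no nonzero ideal meeting the Cartan subalgebra trivially. The map \<open>cart\<close> is the inclusion
  of the Cartan subalgebra.
\<close>

locale affine_kac_moody_algebra =
  affine_realization hscale X n coroot simple_root + lie_algebra gscale bracket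
  for hscale :: "complex \<Rightarrow> 'h::ab_group_add \<Rightarrow> 'h"
    and X :: affine_type
    and n :: nat
    and coroot :: "nat \<Rightarrow> 'h"
    and simple_root :: "nat \<Rightarrow> 'h \<Rightarrow> complex"
    and gscale :: "complex \<Rightarrow> 'g::ab_group_add \<Rightarrow> 'g"
    and bracket :: "'g \<Rightarrow> 'g \<Rightarrow> 'g" +
  fixes cart :: "'h \<Rightarrow> 'g"
    and e f :: "nat \<Rightarrow> 'g"
  assumes cart_linear: "Vector_Spaces.linear hscale gscale cart"
    and cart_inj: "inj cart"
    and cart_cart: "bracket (cart h) (cart h') = 0"
    and e_f: "i \<le> n \<Longrightarrow> j \<le> n \<Longrightarrow> bracket (e i) (f j) = (if i = j then cart (coroot i) else 0)"
    and cart_e: "i \<le> n \<Longrightarrow> bracket (cart h) (e i) = gscale (simple_root i h) (e i)"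
    and cart_f: "i \<le> n \<Longrightarrow> bracket (cart h) (f i) = gscale (- simple_root i h) (f i)"
    and generated: "generated_subalgebra (range cart \<union> e ` {..n} \<union> f ` {..n}) = UNIV"
    and no_ideals: "lie_ideal J \<Longrightarrow> J \<inter> range cart = {0} \<Longrightarrow> J = {0}"
begin

definition n_plus :: "'g set" where
  "n_plus = generated_subalgebra (e ` {..n})"

end


section \<open>Highest weight modules and maximal weights\<close>

locale affine_module =
  affine_kac_moody_algebra hscale X n coroot simple_root gscale bracket cart e f +
  lie_module gscale bracket vscale act
  for hscale :: "complex \<Rightarrow> 'h::ab_group_add \<Rightarrow> 'h"
    and X :: affine_type
    and n :: nat
    and coroot :: "nat \<Rightarrow> 'h"
    and simple_root :: "nat \<Rightarrow> 'h \<Rightarrow> complex"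
    and gscale :: "complex \<Rightarrow> 'g::ab_group_add \<Rightarrow> 'g"
    and bracket :: "'g \<Rightarrow> 'g \<Rightarrow> 'g"
    and cart :: "'h \<Rightarrow> 'g"
    and e f :: "nat \<Rightarrow> 'g"
    and vscale :: "complex \<Rightarrow> 'v::ab_group_add \<Rightarrow> 'v"
    and act :: "'g \<Rightarrow> 'v \<Rightarrow> 'v"
begin

definition weight_space :: "('h \<Rightarrow> complex) \<Rightarrow> 'v set" where
  "weight_space \<mu> = {v. \<forall>h. act (cart h) v = vscale (\<mu> h) v}"

definition weights :: "('h \<Rightarrow> complex) set" where
  "weights = {\<mu>. Vector_Spaces.linear hscale (*) \<mu> \<and> weight_space \<mu> \<noteq> {0}}"

definition highest_weight_module :: "('h \<Rightarrow> complex) \<Rightarrow> bool" where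
  "highest_weight_module \<Lambda> \<longleftrightarrow>
     (\<exists>v. v \<noteq> 0 \<and> v \<in> weight_space \<Lambda> \<and> (\<forall>x\<in>n_plus. act x v = 0) \<and>
          generated_submodule {v} = UNIV)"

definition maximal_weights :: "('h \<Rightarrow> complex) set" where
  "maximal_weights = {\<mu> \<in> weights. (\<lambda>h. \<mu> h + null_root h) \<notin> weights}"

definition dominant_maximal_weights :: "('h \<Rightarrow> complex) set" where
  "dominant_maximal_weights = {\<mu> \<in> maximal_weights. dominant_integral \<mu>}"

end

text \<open>
  The module being irreducible, it is the module \<open>V(\<Lambda>)\<close>, unique up to isomorphism.
\<close>

locale irreducible_highest_weight_module =
  affine_module hscale X n coroot simple_root gscale bracket cart e f vscale act
  for hscale :: "complex \<Rightarrow> 'h::ab_group_add \<Rightarrow> 'h"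
    and X :: affine_type
    and n :: nat
    and coroot :: "nat \<Rightarrow> 'h"
    and simple_root :: "nat \<Rightarrow> 'h \<Rightarrow> complex"
    and gscale :: "complex \<Rightarrow> 'g::ab_group_add \<Rightarrow> 'g"
    and bracket :: "'g \<Rightarrow> 'g \<Rightarrow> 'g"
    and cart :: "'h \<Rightarrow> 'g"
    and e f :: "nat \<Rightarrow> 'g"
    and vscale :: "complex \<Rightarrow> 'v::ab_group_add \<Rightarrow> 'v"
    and act :: "'g \<Rightarrow> 'v \<Rightarrow> 'v" +
  fixes \<Lambda> :: "'h \<Rightarrow> complex"
  assumes irreducible: irreducible_module
    and highest_weight: "highest_weight_module \<Lambda>"

end

theory Submission
  imports Defs
begin

text \<open>
  If a weight vector \<open>u \<in> V\<^sub>\<mu>\<close> is killed by \<open>f\<^sub>i\<close>, then \<open>sl\<^sub>2\<close>-theory and the local nilpotency of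
  \<open>e\<^sub>i\<close> force \<open>\<mu>(h\<^sub>i) \<le> 0\<close>. Combined with a maximum principle for the affine Cartan matrix \<open>A\<close> this
  shows, as in Kac, Proposition 11.2, that at positive level every dominant \<open>\<lambda> \<le> \<Lambda>\<close> is a weight of
  \<open>V(\<Lambda>)\<close>. As the kernel of \<open>A\<close> is spanned by the marks, each dominant class modulo the null root in
  \<open>\<Lambda> + Q\<close> then contains exactly one maximal weight, so dominant maximal weights correspond to the
  vectors \<open>m\<close> of nonnegative coroot values with \<open>m - \<Lambda> \<in> A \<int>\<^sup>n\<^sup>+\<^sup>1\<close>. This lattice is cut out of
  the vectors of level zero by at most one parity condition. The counts follow by substituting away
  the parities and, for type \<open>C\<close>, from a signed count of compositions.
\<close>

section \<open>Counting compositions\<close>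

text \<open>Nilpotency of \<open>e i\<close> on a weight vector comes from the shape of the weights:
  each is \<open>\<Lambda>\<close> minus a nonnegative combination of simple roots, and raising too
  often would leave this cone. Fixing the coroot values confines a weight to a string along the null
  root. The string is bounded above by the same cone, and all its members in the cone are weights,
  so its top is the one maximal weight. This needs a nonzero coroot value; at level zero all of them
  vanish and the module turns out to be one-dimensional. The counts use that comarks are 1 or 2.
  Fixing the parity of a label of comark 1 and writing it as 2 k + r makes it count double, like the
  others, so plain compositions remain. In type C all comarks are 1 and only one sum of labels has a
  fixed parity, whence the averaging over a sign.\<close>

definition tuples :: "nat \<Rightarrow> nat \<Rightarrow> (nat \<Rightarrow> nat) set" where
  "tuples n l = {m. (\<forall>i>n. m i = 0) \<and> (\<Sum>i\<le>n. m i) = l}"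

lemma tuples_0_left: "tuples 0 l = {(\<lambda>_. 0)(0 := l)}"
  by (auto simp: tuples_def fun_eq_iff)

lemma tuples_0_right: "tuples n 0 = {\<lambda>_. 0}"
  by (auto simp: tuples_def fun_eq_iff) (metis atMost_iff not_le)

lemma tuples_Suc_Suc:
  "tuples (Suc n) (Suc l) =
     tuples n (Suc l) \<union> (\<lambda>m. m(Suc n := Suc (m (Suc n)))) ` tuples (Suc n) l"
  (is "?L = ?A \<union> ?g ` ?B")
proof (intro equalityI subsetI)
  fix m assume m: "m \<in> ?L"
  show "m \<in> ?A \<union> ?g ` ?B"
  proof (cases "m (Suc n)")
    case 0
    then have "m i = 0" if "i > n" for i
      using m that by (cases "i = Suc n") (auto simp: tuples_def)
    with m 0 have "m \<in> ?A" by (simp add: tuples_def)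
    then show ?thesis ..
  next
    case (Suc k)
    have "m(Suc n := k) \<in> ?B"
      using m Suc by (simp add: tuples_def)
    moreover have "m = ?g (m(Suc n := k))"
      using Suc by (simp add: fun_eq_iff)
    ultimately show ?thesis by blast
  qed
next
  fix m assume "m \<in> ?A \<union> ?g ` ?B"
  then show "m \<in> ?L"
    by (auto simp: tuples_def)
qed

lemma finite_tuples: "finite (tuples n l)"
proof (induction n arbitrary: l)
  case 0
  show ?case by (simp add: tuples_0_left)
next
  case (Suc n)
  show ?case
    by (induction l) (simp_all add: tuples_0_right tuples_Suc_Suc Suc.IH)
qed

text \<open>The sum is the complete homogeneous polynomial h_l(x_0, ..., x_n), split by whether the
  last part is 0 or can be lowered by one. With x general, one recursion serves the plain count (all
  x_i = 1) and the signed count (x_i = (-1)^i).\<close>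

lemma sum_tuples_Suc_Suc:
  fixes x :: "nat \<Rightarrow> 'a::comm_semiring_1"
  shows "(\<Sum>m\<in>tuples (Suc n) (Suc l). \<Prod>i\<le>Suc n. x i ^ m i) =
    (\<Sum>m\<in>tuples n (Suc l). \<Prod>i\<le>n. x i ^ m i) +
    x (Suc n) * (\<Sum>m\<in>tuples (Suc n) l. \<Prod>i\<le>Suc n. x i ^ m i)"
proof -
  let ?g = "\<lambda>m. m(Suc n := Suc (m (Suc n)))"
  let ?w = "\<lambda>m. \<Prod>i\<le>Suc n. x i ^ m i"
  have "inj_on ?g (tuples (Suc n) l)"
  proof (rule inj_onI)
    fix a b :: "nat \<Rightarrow> nat" assume "?g a = ?g b"
    then have eq: "?g a i = ?g b i" for i by simp
    show "a = b"
    proof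
      fix i show "a i = b i"
        using eq[of i] by (cases "i = Suc n") simp_all
    qed
  qed
  then have "sum ?w (?g ` tuples (Suc n) l) = (\<Sum>m\<in>tuples (Suc n) l. ?w (?g m))"
    by (simp add: sum.reindex)
  also have "\<dots> = x (Suc n) * (\<Sum>m\<in>tuples (Suc n) l. ?w m)"
    by (simp add: sum_distrib_left ac_simps)
  finally have 1: "sum ?w (?g ` tuples (Suc n) l) = x (Suc n) * (\<Sum>m\<in>tuples (Suc n) l. ?w m)" .
  have 2: "sum ?w (tuples n (Suc l)) = (\<Sum>m\<in>tuples n (Suc l). \<Prod>i\<le>n. x i ^ m i)"
    by (rule sum.cong) (auto simp: tuples_def)
  have "tuples n (Suc l) \<inter> ?g ` tuples (Suc n) l = {}"
    by (auto simp: tuples_def)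
  then have "sum ?w (tuples (Suc n) (Suc l)) =
      sum ?w (tuples n (Suc l)) + sum ?w (?g ` tuples (Suc n) l)"
    unfolding tuples_Suc_Suc by (intro sum.union_disjoint) (simp_all add: finite_tuples)
  with 1 2 show ?thesis by simp
qed

lemma card_tuples: "card (tuples n l) = (n + l) choose n"
proof (induction n arbitrary: l)
  case 0
  show ?case by (simp add: tuples_0_left)
next
  case (Suc n)
  show ?case
  proof (induction l)
    case 0
    show ?case by (simp add: tuples_0_right)
  next
    case (Suc l)
    then show ?case
      using sum_tuples_Suc_Suc[of "\<lambda>_. 1 :: nat" n l] \<open>\<And>l. card (tuples n l) = _\<close> by simp
  qed
qed

text \<open>This is h_l at 1, -1, 1, -1, ... In the step from n, l to n + 1, l + 1 the two terms of
  the recursion cancel if n and l are even and add up by Pascal's rule if both are odd; otherwise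
  one of them is zero.\<close>

lemma signed_sum_tuples:
  "(\<Sum>m\<in>tuples n l. \<Prod>i\<le>n. ((-1) ^ i) ^ m i :: int) =
     (if even (n * l) then int (((n + l) div 2) choose (n div 2)) else 0)"
proof (induction n arbitrary: l)
  case 0
  show ?case by (simp add: tuples_0_left)
next
  case IH: (Suc n)
  show ?case
  proof (induction l)
    case 0
    show ?case by (simp add: tuples_0_right)
  next
    case (Suc l)
    obtain a where a: "n = 2 * a \<or> n = Suc (2 * a)" by (metis odd_Suc_minus_one oddE evenE Suc_eq_plus1)
    obtain b where b: "l = 2 * b \<or> l = Suc (2 * b)" by (metis odd_Suc_minus_one oddE evenE Suc_eq_plus1)
    have s: "Suc (2 * a + 2 * b) div 2 = a + b" "Suc (2 * b + 2 * a) div 2 = a + b" "(2 * a + 2 * b) div 2 = a + b" for a b :: nat by auto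
    from a b show ?case
      unfolding sum_tuples_Suc_Suc Suc IH
      by (elim disjE) (simp_all add: s)
  qed
qed

text \<open>Division with remainder in each entry. As \<open>b i * q i = 2\<close>, raising any
  quotient by one raises the weighted sum by exactly 2, so the weights disappear. Where
  \<open>q i = 1\<close> the residue condition is empty.\<close>

lemma bij_betw_tuples_weighted:
  assumes "\<And>i. i \<le> n \<Longrightarrow> b i * q i = 2" "\<And>i. i \<le> n \<Longrightarrow> r i < q i"
  shows "bij_betw (\<lambda>k i. if i \<le> n then q i * k i + r i else 0) (tuples n K)
    {m. (\<forall>i>n. m i = 0) \<and> (\<Sum>i\<le>n. b i * m i) = (\<Sum>i\<le>n. b i * r i) + 2 * K \<and>
        (\<forall>i\<le>n. m i mod q i = r i)}"
    (is "bij_betw ?g _ ?S")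
proof (rule bij_betw_byWitness[where f' = "\<lambda>m i. if i \<le> n then m i div q i else 0"])
  have sum: "(\<Sum>i\<le>n. b i * (q i * k i + r i)) = (\<Sum>i\<le>n. b i * r i) + 2 * (\<Sum>i\<le>n. k i)" for k
  proof -
    have "b i * (q i * k i + r i) = b i * r i + 2 * k i" if "i \<le> n" for i
    proof -
      have "b i * (q i * k i + r i) = (b i * q i) * k i + b i * r i"
        by (simp only: distrib_left mult.assoc)
      then show ?thesis using assms(1)[OF that] by simp
    qed
    then show ?thesis by (simp add: sum.distrib sum_distrib_left)
  qed
  show "\<forall>k\<in>tuples n K. (\<lambda>i. if i \<le> n then ?g k i div q i else 0) = k"
  proof (intro ballI ext)
    fix k i assume "k \<in> tuples n K"
    then show "(if i \<le> n then ?g k i div q i else 0) = k i"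
      using assms(2)[of i] by (auto simp: tuples_def)
  qed
  show "\<forall>m\<in>?S. ?g (\<lambda>i. if i \<le> n then m i div q i else 0) = m"
  proof (intro ballI ext)
    fix m i assume "m \<in> ?S"
    then have "i > n \<Longrightarrow> m i = 0" "i \<le> n \<Longrightarrow> m i mod q i = r i" by auto
    then show "?g (\<lambda>i. if i \<le> n then m i div q i else 0) i = m i"
      using mult_div_mod_eq[of "q i" "m i"] by (cases "i \<le> n") simp_all
  qed
  show "?g ` tuples n K \<subseteq> ?S"
    using assms(2) by (auto simp: tuples_def sum)
  show "(\<lambda>m i. if i \<le> n then m i div q i else 0) ` ?S \<subseteq> tuples n K"
  proof (rule image_subsetI)
    fix m assume m: "m \<in> ?S"
    have "q i * (m i div q i) + r i = m i" if "i \<le> n" for i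
    proof -
      have "m i mod q i = r i" using m that by blast
      then show ?thesis using mult_div_mod_eq[of "q i" "m i"] by simp
    qed
    then have "(\<Sum>i\<le>n. b i * m i) = (\<Sum>i\<le>n. b i * (q i * (m i div q i) + r i))"
      by simp
    with m have "(\<Sum>i\<le>n. m i div q i) = K"
      unfolding sum by simp
    then show "(\<lambda>i. if i \<le> n then m i div q i else 0) \<in> tuples n K"
      by (simp add: tuples_def)
  qed
qed

lemma card_tuples_weighted:
  assumes "\<And>i. i \<le> n \<Longrightarrow> b i * q i = 2" "\<And>i. i \<le> n \<Longrightarrow> r i < q i"
    and l: "l = (\<Sum>i\<le>n. b i * r i) + 2 * K"
  defines "S \<equiv> {m. (\<forall>i>n. m i = 0) \<and> (\<Sum>i\<le>n. b i * m i) = l \<and> (\<forall>i\<le>n. m i mod q i = r i)}"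
  shows "finite S \<and> card S = (n + K) choose n"
proof -
  have bij: "bij_betw (\<lambda>k i. if i \<le> n then q i * k i + r i else 0) (tuples n K) S"
    using bij_betw_tuples_weighted[of n b q r K] assms(1,2) by (simp add: S_def l)
  show ?thesis
    using bij_betw_same_card[OF bij] bij_betw_finite[OF bij] card_tuples[of n K]
      finite_tuples[of n K] by simp
qed

text \<open>Each residue is a lower bound for its entry. This covers the levels at which the number
  \<open>K\<close> of remaining pairs would be negative.\<close>

lemma tuples_weighted_empty:
  fixes b q r :: "nat \<Rightarrow> nat"
  assumes "l < (\<Sum>i\<le>n. b i * r i)"
  shows "{m. (\<forall>i>n. m i = 0) \<and> (\<Sum>i\<le>n. b i * m i) = l \<and> (\<forall>i\<le>n. m i mod q i = r i)} = {}"
proof -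
  have le: "(\<Sum>i\<le>n. b i * r i) \<le> (\<Sum>i\<le>n. b i * m i)" if "\<forall>i\<le>n. m i mod q i = r i" for m
  proof (intro sum_mono mult_left_mono)
    fix i assume "i \<in> {..n}"
    with that have "m i mod q i = r i" by simp
    then show "r i \<le> m i" using mod_less_eq_dividend[of "m i" "q i"] by simp
  qed simp
  show ?thesis
  proof (intro equals0I, elim CollectE conjE)
    fix m assume m: "(\<Sum>i\<le>n. b i * m i) = l" "\<forall>i\<le>n. m i mod q i = r i"
    with assms le[OF m(2)] show False by linarith
  qed
qed

section \<open>Affine Cartan matrices and their root lattices\<close>

lemma affine_cartan_off_diagonal: "i \<noteq> j \<Longrightarrow> affine_cartan X n i j \<le> 0"
  by (cases X) auto

lemma affine_cartan_diagonal: "affine_cartan X n i i = 2"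
  by (cases X) auto

lemma affine_cartan_adjacent:
  assumes "X = AffB \<Longrightarrow> 1 \<le> j"
  shows "affine_cartan X n j (Suc j) \<noteq> 0" "affine_cartan X n (Suc j) j \<noteq> 0"
proof -
  consider "n = j" | "n = Suc j" | "n \<noteq> j" "n \<noteq> Suc j" by blast
  then have "affine_cartan X n j (Suc j) \<noteq> 0 \<and> affine_cartan X n (Suc j) j \<noteq> 0"
    by cases (use assms in \<open>cases X; simp add: doubleton_eq_iff\<close>)+
  then show "affine_cartan X n j (Suc j) \<noteq> 0" "affine_cartan X n (Suc j) j \<noteq> 0" by auto
qed

lemma mark_pos: "mark X n i > 0"
  by (cases X) auto

lemma comark_pos: "comark X n i > 0"
  by (cases X) auto

lemma interval_subset_if_closed:
  fixes a n i :: nat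
  assumes i: "i \<in> E" "a \<le> i" "i \<le> n"
    and up: "\<And>j. a \<le> j \<Longrightarrow> j < n \<Longrightarrow> j \<in> E \<Longrightarrow> Suc j \<in> E"
    and down: "\<And>j. a \<le> j \<Longrightarrow> j < n \<Longrightarrow> Suc j \<in> E \<Longrightarrow> j \<in> E"
  shows "{a..n} \<subseteq> E"
proof
  fix k assume k: "k \<in> {a..n}"
  show "k \<in> E"
  proof (cases "i \<le> k")
    case True
    then have "k \<le> n \<longrightarrow> k \<in> E"
      by (induction k rule: dec_induct) (use i up in auto)
    with k show ?thesis by simp
  next
    case False
    then have "k \<le> i" by simp
    then have "a \<le> k \<longrightarrow> k \<in> E"
      by (induction k rule: inc_induct) (use i down in auto)
    with k show ?thesis by simp
  qed
qed

text \<open>Connectedness of the diagram, phrased for spreading a set of maximisers along edges. In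
  \<open>AffB\<close> the path starts at 1, and 0 is reached through 2.\<close>

lemma affine_cartan_connected:
  assumes n: "min_rank X \<le> n" and E: "i \<in> E" "i \<le> n"
    and closed: "\<And>i j. i \<in> E \<Longrightarrow> i \<le> n \<Longrightarrow> j \<le> n \<Longrightarrow> affine_cartan X n i j \<noteq> 0 \<Longrightarrow> j \<in> E"
  shows "{..n} \<subseteq> E"
proof (cases "X = AffB")
  case True
  obtain i' where "i' \<in> E" "1 \<le> i'" "i' \<le> n"
  proof (cases "i = 0")
    case True
    with E closed[of i 2] \<open>X = AffB\<close> n that[of 2] show ?thesis
      by (auto simp: doubleton_eq_iff)
  next
    case False
    with E that[of i] show ?thesis by simp
  qed
  moreover have "affine_cartan X n j (Suc j) \<noteq> 0" "affine_cartan X n (Suc j) j \<noteq> 0" if "1 \<le> j" for j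
    using affine_cartan_adjacent[of X j] that by auto
  ultimately have *: "{1..n} \<subseteq> E"
    by (elim interval_subset_if_closed) (metis closed Suc_leI less_imp_le)+
  moreover have "0 \<in> E"
  proof -
    have "2 \<in> E" using * True n by (simp add: subset_iff)
    then show ?thesis using closed[of 2 0] True n by (simp add: doubleton_eq_iff)
  qed
  moreover have "{..n} = insert 0 {1..n}" by auto
  ultimately show ?thesis by simp
next
  case False
  have "affine_cartan X n j (Suc j) \<noteq> 0" "affine_cartan X n (Suc j) j \<noteq> 0" for j
    using affine_cartan_adjacent[of X j] False by auto
  with E(1) le0 E(2) have "{0..n} \<subseteq> E"
    by (elim interval_subset_if_closed) (metis closed Suc_leI less_imp_le)+
  then show ?thesis by (simp add: atLeast0AtMost)
qed

text \<open>
  The maximum principle for the generalized Laplacian \<open>A\<close>, applied to the ratios \<open>u\<^sub>i / a\<^sub>i\<close>: at a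
  vertex where the ratio is largest, \<open>(A u)\<^sub>i = \<Sum>\<^sub>j a\<^sub>i\<^sub>j a\<^sub>j (u\<^sub>j / a\<^sub>j - u\<^sub>i / a\<^sub>i)\<close> is a sum of nonnegative terms.
\<close>

lemma affine_maximum_principle:
  fixes u :: "nat \<Rightarrow> int"
  assumes n: "min_rank X \<le> n" and pos: "k \<le> n" "u k > 0"
    and le: "\<And>i. i \<le> n \<Longrightarrow> u i > 0 \<Longrightarrow> (\<Sum>j\<le>n. affine_cartan X n i j * u j) \<le> 0"
  shows "\<exists>t>0. \<forall>i\<le>n. u i = t * int (mark X n i)"
proof -
  define r where "r i = real_of_int (u i) / real (mark X n i)" for i
  have u: "real_of_int (u i) = real (mark X n i) * r i" for i
    using mark_pos[of X n i] by (simp add: r_def)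
  define E where "E = {i. i \<le> n \<and> (\<forall>j\<le>n. r j \<le> r i)}"
  have "Max (r ` {..n}) \<in> r ` {..n}" by (intro Max_in) auto
  then obtain i0 where "i0 \<le> n" "Max (r ` {..n}) = r i0" by blast
  then have i0: "i0 \<in> E" "i0 \<le> n" using Max_ge[of "r ` {..n}"] by (auto simp: E_def)
  have "{..n} \<subseteq> E"
  proof (rule affine_cartan_connected[OF n i0])
    fix i j assume i: "i \<in> E" "i \<le> n" and j: "j \<le> n" "affine_cartan X n i j \<noteq> 0"
    let ?A = "\<lambda>j. real_of_int (affine_cartan X n i j)"
    let ?t = "\<lambda>j. ?A j * (real (mark X n j) * (r j - r i))"
    \<comment> \<open>The hypothesis \<open>le\<close> speaks of positive entries only. The ratio at
      \<open>k\<close> is positive, hence so is the largest one, and \<open>le\<close> applies at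
      every maximiser.\<close>
    have "r k > 0" using pos mark_pos[of X n k] by (simp add: r_def)
    also have "r k \<le> r i" using i pos by (simp add: E_def)
    finally have "u i > 0" using mark_pos[of X n i] by (simp add: r_def zero_less_divide_iff)
    then have "(\<Sum>j\<le>n. affine_cartan X n i j * u j) \<le> 0" using le i by blast
    then have "real_of_int (\<Sum>j\<le>n. affine_cartan X n i j * u j) \<le> 0" by linarith
    moreover have "real_of_int (\<Sum>j\<le>n. affine_cartan X n i j * int (mark X n j)) = 0"
      using mark_comark_null[OF n i(2)] by simp
    ultimately have "(\<Sum>j\<le>n. ?A j * real_of_int (u j)) - r i * (\<Sum>j\<le>n. ?A j * real (mark X n j)) \<le> 0"
      by simp
    then have sum: "(\<Sum>j\<le>n. ?t j) \<le> 0"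
      by (simp add: u sum_distrib_left sum_subtractf algebra_simps)
    have nonneg: "?t j \<ge> 0" if "j \<le> n" for j
    proof (cases "j = i")
      case False
      have "real (mark X n j) * (r j - r i) \<le> 0"
        using i(1) that by (intro mult_nonneg_nonpos) (auto simp: E_def)
      with False show ?thesis
        using affine_cartan_off_diagonal[of i j X n] by (intro mult_nonpos_nonpos) auto
    qed simp
    then have "(\<Sum>j\<le>n. ?t j) \<ge> 0" by (intro sum_nonneg) auto
    with sum have "(\<Sum>j\<le>n. ?t j) = 0" by simp
    then have "?t j = 0"
      using nonneg j by (subst (asm) sum_nonneg_eq_0_iff) auto
    then have "r j = r i" using j mark_pos[of X n j] by simp
    with i j show "j \<in> E" by (simp add: E_def)
  qed
  then have r_const: "r i = r j" if "i \<le> n" "j \<le> n" for i j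
    using that by (intro antisym) (auto simp: E_def)
  \<comment> \<open>A vertex of mark 1 identifies the common ratio with the integer
    \<open>u p\<close>.\<close>
  obtain p where p: "p \<le> n" "mark X n p = 1" using mark_coprime by blast
  have "u i = u p * int (mark X n i)" if "i \<le> n" for i
  proof -
    have "real_of_int (u i) = real_of_int (u p) * real (mark X n i)"
      using u[of i] u[of p] p r_const[OF that p(1)] by simp
    then show ?thesis
      by (metis of_int_eq_iff of_int_mult of_int_of_nat_eq)
  qed
  moreover have "u p > 0"
    using calculation[OF pos(1)] pos(2) mark_pos[of X n k] by (simp add: zero_less_mult_iff)
  ultimately show ?thesis by blast
qed

text \<open>Adding a large multiple of the marks stays in the kernel and makes the entry at 0
  positive, so the maximum principle applies.\<close>

lemma affine_kernel:
  fixes c :: "nat \<Rightarrow> int"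
  assumes n: "min_rank X \<le> n"
    and zero: "\<And>i. i \<le> n \<Longrightarrow> (\<Sum>j\<le>n. affine_cartan X n i j * c j) = 0"
  shows "\<exists>t. \<forall>i\<le>n. c i = t * int (mark X n i)"
proof -
  define K where "K = 1 + (\<Sum>i\<le>n. \<bar>c i\<bar>)"
  have "c 0 + K * int (mark X n 0) > 0"
  proof -
    have "\<bar>c 0\<bar> \<le> (\<Sum>i\<le>n. \<bar>c i\<bar>)" by (rule member_le_sum) auto
    moreover have "K * int (mark X n 0) \<ge> K * 1"
      using mark_pos[of X n 0] by (intro mult_left_mono) (auto simp: K_def intro: sum_nonneg add_nonneg_nonneg)
    ultimately show ?thesis by (simp add: K_def)
  qed
  moreover have "(\<Sum>j\<le>n. affine_cartan X n i j * (c j + K * int (mark X n j))) = 0" if "i \<le> n" for i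
  proof -
    have "(\<Sum>j\<le>n. affine_cartan X n i j * (c j + K * int (mark X n j))) =
       (\<Sum>j\<le>n. affine_cartan X n i j * c j) + K * (\<Sum>j\<le>n. affine_cartan X n i j * int (mark X n j))"
      by (simp add: algebra_simps sum.distrib sum_distrib_left)
    then show ?thesis using mark_comark_null[OF n that] zero[OF that] by simp
  qed
  ultimately obtain t where "\<forall>i\<le>n. c i + K * int (mark X n i) = t * int (mark X n i)"
    using affine_maximum_principle[OF n le0, of "\<lambda>i. c i + K * int (mark X n i)"] by auto
  then have "\<forall>i\<le>n. c i = (t - K) * int (mark X n i)"
    by (auto simp: algebra_simps)
  then show ?thesis ..
qed

section \<open>The root lattice inside the vectors of level zero\<close>

lemma affine_cartan_eq_0:
  "j \<noteq> i \<Longrightarrow> j \<noteq> i + 1 \<Longrightarrow> i \<noteq> j + 1 \<Longrightarrow> (X = AffB \<Longrightarrow> {i, j} \<noteq> {0, 2}) \<Longrightarrow>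
    affine_cartan X n i j = 0"
  by (cases X) auto

text \<open>The invariant that, read modulo 2, separates the root lattice from the vectors of level zero.\<close>

fun class_index :: "affine_type \<Rightarrow> nat \<Rightarrow> (nat \<Rightarrow> int) \<Rightarrow> int" where
  "class_index AffB n x = x n"
| "class_index AffC n x = (\<Sum>i\<le>n. if odd i then x i else 0)"
| "class_index TwA n x = 0"
| "class_index TwD n x = x n"

lemma affine_row_sum:
  fixes c :: "nat \<Rightarrow> int"
  assumes "0 < i" "i < n" "X = AffB \<Longrightarrow> 3 \<le> i"
  shows "(\<Sum>j\<le>n. affine_cartan X n i j * c j) =
    affine_cartan X n i (i - 1) * c (i - 1) + 2 * c i + affine_cartan X n i (i + 1) * c (i + 1)"
proof -
  obtain k where k: "i = Suc k" using assms(1) gr0_implies_Suc by blast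
  have "(\<Sum>j\<le>n. affine_cartan X n i j * c j) =
      (\<Sum>j\<in>{k, Suc k, Suc (Suc k)}. affine_cartan X n i j * c j)"
  proof (rule sum_restrict)
    fix j assume "j \<le> n" "j \<notin> {k, Suc k, Suc (Suc k)}"
    then show "affine_cartan X n i j * c j = 0"
      using assms k by (subst affine_cartan_eq_0) (auto simp: doubleton_eq_iff)
  qed (use assms k in auto)
  then show ?thesis by (simp add: k affine_cartan_diagonal)
qed

lemma affine_first_row_sum:
  fixes c :: "nat \<Rightarrow> int"
  assumes "min_rank X \<le> n" "X \<noteq> AffB"
  shows "(\<Sum>j\<le>n. affine_cartan X n 0 j * c j) = 2 * c 0 + affine_cartan X n 0 1 * c 1"
proof -
  have "n > 0" using assms by (cases X) auto
  then have "(\<Sum>j\<le>n. affine_cartan X n 0 j * c j) = (\<Sum>j\<in>{0, 1}. affine_cartan X n 0 j * c j)"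
    using assms by (intro sum_restrict) (auto intro!: affine_cartan_eq_0)
  then show ?thesis by (simp add: affine_cartan_diagonal)
qed

lemma affine_last_row_sum:
  fixes c :: "nat \<Rightarrow> int"
  assumes "min_rank X \<le> n"
  shows "(\<Sum>j\<le>n. affine_cartan X n n j * c j) = affine_cartan X n n (n - 1) * c (n - 1) + 2 * c n"
proof -
  obtain k where k: "n = Suc k" using assms by (cases X; cases n) auto
  have "(\<Sum>j\<le>n. affine_cartan X n n j * c j) = (\<Sum>j\<in>{k, Suc k}. affine_cartan X n n j * c j)"
  proof (rule sum_restrict)
    fix j assume "j \<le> n" "j \<notin> {k, Suc k}"
    then show "affine_cartan X n n j * c j = 0"
      using assms k by (subst affine_cartan_eq_0) (auto simp: doubleton_eq_iff)
  qed (use k in auto)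
  then show ?thesis by (simp add: k affine_cartan_diagonal)
qed

text \<open>The rows around the fork of the diagram, which \<open>affine_row_sum\<close> leaves
  out.\<close>

lemma AffB_row_sum:
  fixes c :: "nat \<Rightarrow> int"
  assumes "3 \<le> n"
  shows "(\<Sum>j\<le>n. affine_cartan AffB n 0 j * c j) = 2 * c 0 - c 2"
    and "(\<Sum>j\<le>n. affine_cartan AffB n 1 j * c j) = 2 * c 1 - c 2"
    and "(\<Sum>j\<le>n. affine_cartan AffB n 2 j * c j) = 2 * c 2 - c 0 - c 1 - c 3"
proof -
  have "(\<Sum>j\<le>n. affine_cartan AffB n 0 j * c j) = (\<Sum>j\<in>{0,2}. affine_cartan AffB n 0 j * c j)"
    using assms by (intro sum_restrict) (auto simp: doubleton_eq_iff)
  then show "(\<Sum>j\<le>n. affine_cartan AffB n 0 j * c j) = 2 * c 0 - c 2"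
    by (simp add: doubleton_eq_iff)
  have "(\<Sum>j\<le>n. affine_cartan AffB n 1 j * c j) = (\<Sum>j\<in>{1,2}. affine_cartan AffB n 1 j * c j)"
    using assms by (intro sum_restrict) (auto simp: doubleton_eq_iff)
  then show "(\<Sum>j\<le>n. affine_cartan AffB n 1 j * c j) = 2 * c 1 - c 2"
    using assms by (simp add: doubleton_eq_iff)
  have "(\<Sum>j\<le>n. affine_cartan AffB n 2 j * c j) = (\<Sum>j\<in>{0,1,2,3}. affine_cartan AffB n 2 j * c j)"
    using assms by (intro sum_restrict) (auto simp: doubleton_eq_iff)
  then show "(\<Sum>j\<le>n. affine_cartan AffB n 2 j * c j) = 2 * c 2 - c 0 - c 1 - c 3"
    using assms by (simp add: doubleton_eq_iff)
qed

lemma affine_root_lattice_level: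
  fixes c :: "nat \<Rightarrow> int"
  assumes "min_rank X \<le> n"
  shows "(\<Sum>i\<le>n. int (comark X n i) * (\<Sum>j\<le>n. affine_cartan X n i j * c j)) = 0"
proof -
  have "(\<Sum>i\<le>n. int (comark X n i) * (\<Sum>j\<le>n. affine_cartan X n i j * c j)) =
      (\<Sum>i\<le>n. \<Sum>j\<le>n. int (comark X n i) * affine_cartan X n i j * c j)"
    by (simp add: sum_distrib_left mult.assoc)
  also have "\<dots> = (\<Sum>j\<le>n. (\<Sum>i\<le>n. int (comark X n i) * affine_cartan X n i j) * c j)"
    by (subst sum.swap) (simp add: sum_distrib_right)
  also have "\<dots> = 0"
    using mark_comark_null[OF assms] by (intro sum.neutral) simp
  finally show ?thesis .
qed

text \<open>If j is odd, its neighbours are even and only the diagonal entry 2 is counted. If j is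
  even, only the neighbours are counted: a single -2 in the two end columns, twice -1 in the
  others.\<close>

lemma AffC_column_parity:
  assumes "2 \<le> n" "j \<le> n"
  shows "even (\<Sum>i\<le>n. if odd i then affine_cartan AffC n i j else 0)"
proof (cases "odd j")
  case True
  have "(\<Sum>i\<le>n. if odd i then affine_cartan AffC n i j else 0) =
      (\<Sum>i\<in>{j}. if odd i then affine_cartan AffC n i j else 0)"
  proof (rule sum_restrict)
    fix i assume "i \<le> n" "i \<notin> {j}"
    with True show "(if odd i then affine_cartan AffC n i j else 0) = 0"
      by (cases "odd i"; intro if_not_P trans[OF if_P] affine_cartan_eq_0) auto
  qed (use assms in auto)
  then show ?thesis by (simp add: affine_cartan_diagonal)
next
  case False
  let ?g = "\<lambda>i. if odd i then affine_cartan AffC n i j else 0"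
  consider "j = 0" | k where "j = Suc k" "n = Suc k" | k where "j = Suc k" "Suc k < n"
    using assms(2) by (metis le_neq_implies_less old.nat.exhaust)
  then show ?thesis
  proof cases
    case 1
    have "(\<Sum>i\<le>n. ?g i) = (\<Sum>i\<in>{1}. ?g i)"
      by (rule sum_restrict) (use assms 1 in \<open>auto intro!: affine_cartan_eq_0\<close>)
    with 1 show ?thesis by simp
  next
    case 2
    have "(\<Sum>i\<le>n. ?g i) = (\<Sum>i\<in>{k}. ?g i)"
    proof (rule sum_restrict)
      fix i assume "i \<le> n" "i \<notin> {k}"
      with False 2 show "?g i = 0"
        by (cases "odd i"; intro if_not_P trans[OF if_P] affine_cartan_eq_0) auto
    qed (use 2 in auto)
    with 2 show ?thesis by simp
  next
    case 3
    have "(\<Sum>i\<le>n. ?g i) = (\<Sum>i\<in>{k, k + 2}. ?g i)"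
    proof (rule sum_restrict)
      fix i assume "i \<le> n" "i \<notin> {k, k + 2}"
      with False 3 show "?g i = 0"
        by (cases "odd i"; intro if_not_P trans[OF if_P] affine_cartan_eq_0) auto
    qed (use 3 in auto)
    with 3 False show ?thesis by simp
  qed
qed

text \<open>For \<open>AffB\<close> and \<open>TwD\<close> the nonzero entries -2, 2 of the last row
  are even; for \<open>AffC\<close> the sums are interchanged and each column is even.\<close>

lemma affine_root_lattice_even:
  fixes c :: "nat \<Rightarrow> int"
  assumes n: "min_rank X \<le> n"
  shows "even (class_index X n (\<lambda>i. \<Sum>j\<le>n. affine_cartan X n i j * c j))"
proof -
  obtain k where k: "n = Suc k" using n by (cases X; cases n) auto
  have last: "(\<Sum>j\<le>n. affine_cartan X n n j * c j) = affine_cartan X n (Suc k) k * c k + 2 * c (Suc k)"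
    using affine_last_row_sum[OF n, of c] k by simp
  show ?thesis
  proof (cases X)
    case AffC
    have "(\<Sum>i\<le>n. if odd i then \<Sum>j\<le>n. affine_cartan X n i j * c j else 0) =
        (\<Sum>i\<le>n. \<Sum>j\<le>n. (if odd i then affine_cartan X n i j else 0) * c j)"
      by (rule sum.cong) (auto intro: sum.neutral)
    also have "\<dots> = (\<Sum>j\<le>n. (\<Sum>i\<le>n. if odd i then affine_cartan X n i j else 0) * c j)"
      by (subst sum.swap) (simp add: sum_distrib_right)
    also have "even \<dots>"
      using AffC_column_parity n AffC by (intro dvd_sum) auto
    finally show ?thesis by (simp only: AffC class_index.simps)
  qed (use last n k in \<open>auto simp: doubleton_eq_iff\<close>)
qed

text \<open>
  Away from the ends of the diagram, \<open>A c = x\<close> is the recurrence \<open>c\<^sub>k\<^sub>+\<^sub>2 = 2 c\<^sub>k\<^sub>+\<^sub>1 - c\<^sub>k - x\<^sub>k\<^sub>+\<^sub>1\<close>. A double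
  last column halves the final value \<open>c\<^sub>n\<close>, whence the interest in its parity.
\<close>

fun solve_laplace :: "(nat \<Rightarrow> int) \<Rightarrow> int \<Rightarrow> int \<Rightarrow> nat \<Rightarrow> int" where
  "solve_laplace x a b 0 = a"
| "solve_laplace x a b (Suc 0) = b"
| "solve_laplace x a b (Suc (Suc k)) = 2 * solve_laplace x a b (Suc k) - solve_laplace x a b k - x (Suc k)"

text \<open>Constants solve the homogeneous recurrence. In type \<open>TwA\<close> this serves to
  make the last value even.\<close>

lemma solve_laplace_shift:
  "solve_laplace x (a + t) (b + t) k = solve_laplace x a b k + t"
  by (induction x a b k rule: solve_laplace.induct) auto

text \<open>Modulo 2 the recurrence reads c_(k+2) = c_k + x_(k+1), so the value at k collects the
  x_j with j < k of the other parity.\<close>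

lemma solve_laplace_parity:
  "even (solve_laplace x 0 (- x 0) k - (\<Sum>j<k. if odd (j + k) then x j else 0))"
  by (induction k rule: induct_nat_012) (simp_all add: algebra_simps)

text \<open>The defect x - A c has level zero and can be nonzero only at n, where the comark is
  positive. So it is enough to solve the first n rows.\<close>

lemma affine_root_lattice_last_row:
  fixes c x :: "nat \<Rightarrow> int"
  assumes n: "min_rank X \<le> n"
    and level: "(\<Sum>i\<le>n. int (comark X n i) * x i) = 0"
    and rows: "\<And>i. i < n \<Longrightarrow> x i = (\<Sum>j\<le>n. affine_cartan X n i j * c j)"
    and i: "i \<le> n"
  shows "x i = (\<Sum>j\<le>n. affine_cartan X n i j * c j)"
proof (cases "i = n")
  case True
  let ?y = "\<lambda>i. x i - (\<Sum>j\<le>n. affine_cartan X n i j * c j)"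
  have "(\<Sum>i\<le>n. int (comark X n i) * ?y i) = 0"
    using level affine_root_lattice_level[OF n, of c] by (simp add: right_diff_distrib sum_subtractf)
  moreover have "(\<Sum>i\<le>n. int (comark X n i) * ?y i) = (\<Sum>i\<in>{n}. int (comark X n i) * ?y i)"
    by (rule sum_restrict) (use rows in auto)
  ultimately show ?thesis
    using comark_pos[of X n n] True by simp
qed (use i rows in simp)

text \<open>Two deviations from the recurrence are absorbed here: stating the product with
  \<open>c (i + 1)\<close> allows for a last column with -2 and a halved value, and
  \<open>a = 0\<close> hides the entry -2 of \<open>AffC\<close> in row 1, column 0.\<close>

lemma solve_laplace_row:
  assumes i: "0 < i" "i < n" "X = AffB \<Longrightarrow> 3 \<le> i"
    and c: "c (i - 1) = solve_laplace x a b (i - 1)" "X = AffC \<Longrightarrow> a = 0"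
      "c i = solve_laplace x a b i"
      "affine_cartan X n i (i + 1) * c (i + 1) = - solve_laplace x a b (i + 1)"
  shows "x i = (\<Sum>j\<le>n. affine_cartan X n i j * c j)"
proof -
  obtain k where k: "i = Suc k" using i(1) gr0_implies_Suc by blast
  have "affine_cartan X n i (i - 1) = (if X = AffC \<and> i = 1 then -2 else -1)"
    using i by (cases X) (auto simp: doubleton_eq_iff)
  with c have "affine_cartan X n i (i - 1) * c (i - 1) = - solve_laplace x a b (i - 1)"
    by auto
  then show ?thesis
    using i c(3,4) k by (subst affine_row_sum) simp_all
qed

lemma affine_root_lattice_exists:
  fixes x :: "nat \<Rightarrow> int"
  assumes n: "min_rank X \<le> n"
    and level: "(\<Sum>i\<le>n. int (comark X n i) * x i) = 0"
    and even: "even (class_index X n x)"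
  shows "\<exists>c::nat \<Rightarrow> int. \<forall>i\<le>n. x i = (\<Sum>j\<le>n. affine_cartan X n i j * c j)"
proof (cases X)
  case AffB
  then have n3: "3 \<le> n" using n by simp
  \<comment> \<open>Only 0, 1 and n have an odd comark, and x_n is even by the class condition; so
    level zero makes x_0 + x_1 even.\<close>
  have "even (int (comark X n i) * x i)" if "i \<notin> {0, 1}" for i
    using that even AffB by auto
  then have "even (\<Sum>i\<in>{..n} - {0, 1}. int (comark X n i) * x i)"
    by (intro dvd_sum) auto
  moreover have "(\<Sum>i\<le>n. int (comark X n i) * x i) =
      (\<Sum>i\<in>{..n} - {0, 1}. int (comark X n i) * x i) + (\<Sum>i\<in>{0, 1}. int (comark X n i) * x i)"
    using n3 by (intro sum.subset_diff) auto
  ultimately have "even (\<Sum>i\<in>{0, 1}. int (comark X n i) * x i)"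
    using level by presburger
  then have "even (x 1 - x 0)" using AffB by simp
  then obtain b where b: "x 1 - x 0 = 2 * b" by (elim evenE)
  \<comment> \<open>Rows 0 and 1 demand 2 (c_1 - c_0) = x_1 - x_0. With c_0 = 0 this is c_1 = b; the
    recurrence then yields c_2 = -x_0 as in row 0, and c_0 drops out of row 2.\<close>
  define c where "c = solve_laplace x 0 b"
  have c012: "c 0 = 0" "c 1 = b" "c 2 = - x 0" "c 3 = 2 * c 2 - c 1 - x 2"
    using b by (simp_all add: c_def numeral_2_eq_2 numeral_3_eq_3)
  have "x i = (\<Sum>j\<le>n. affine_cartan X n i j * c j)" if "i < n" for i
  proof -
    consider "i = 0" | "i = 1" | "i = 2" | "3 \<le> i" by linarith
    then show ?thesis
    proof cases
      case 4
      then show ?thesis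
      proof (intro solve_laplace_row)
        show "affine_cartan X n i (i + 1) * c (i + 1) = - solve_laplace x 0 b (i + 1)"
          using 4 that AffB by (auto simp: c_def doubleton_eq_iff simp del: solve_laplace.simps)
      qed (use that c_def in auto)
    qed (use b c012 AffB AffB_row_sum[OF n3, of c] in \<open>simp_all only:; simp\<close>)+
  qed
  with affine_root_lattice_last_row[OF n level] show ?thesis by blast
next
  case TwD
  have "even (int (comark X n i) * x i)" if "i \<notin> {0}" for i
    using that even TwD by auto
  then have "even (\<Sum>i\<in>{..n} - {0}. int (comark X n i) * x i)"
    by (intro dvd_sum) auto
  moreover have "(\<Sum>i\<le>n. int (comark X n i) * x i) =
      (\<Sum>i\<in>{..n} - {0}. int (comark X n i) * x i) + (\<Sum>i\<in>{0}. int (comark X n i) * x i)"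
    by (intro sum.subset_diff) auto
  ultimately have "even (\<Sum>i\<in>{0}. int (comark X n i) * x i)"
    using level by presburger
  then have "even (x 0)" using TwD by simp
  then obtain b where b: "x 0 = 2 * b" by (elim evenE)
  \<comment> \<open>Row 0 reads 2 c_0 - 2 c_1 = x_0, so c_0 = 0 forces c_1 = -b.\<close>
  define c where "c = solve_laplace x 0 (- b)"
  have "x i = (\<Sum>j\<le>n. affine_cartan X n i j * c j)" if "i < n" for i
  proof (cases "i = 0")
    case True
    then show ?thesis
      using affine_first_row_sum[OF n, of c] TwD b by (simp add: c_def)
  next
    case False
    then show ?thesis
    proof (intro solve_laplace_row)
      show "affine_cartan X n i (i + 1) * c (i + 1) = - solve_laplace x 0 (- b) (i + 1)"
        using False that TwD by (auto simp: c_def simp del: solve_laplace.simps)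
    qed (use that c_def TwD in auto)
  qed
  with affine_root_lattice_last_row[OF n level] show ?thesis by blast
next
  case AffC
  then have n2: "2 \<le> n" using n by simp
  have sum0: "(\<Sum>i\<le>n. x i) = 0"
    using level AffC by simp
  let ?s = "solve_laplace x 0 (- x 0)"
  \<comment> \<open>Row n - 1 contains -2 c_n, so the recurrence value at n has to be halved. Its
    parity is that of the sum of the x_j with j + n odd, which is the class index or, the total
    being zero, its negative.\<close>
  have "even (\<Sum>j<n. if odd (j + n) then x j else 0)"
  proof -
    have "(\<Sum>j<n. if odd (j + n) then x j else 0) = (\<Sum>j\<le>n. if odd (j + n) then x j else 0)"
      by (simp flip: lessThan_Suc_atMost)
    moreover have "(\<Sum>j\<le>n. if odd (j + n) then x j else 0) =
        (if even n then class_index X n x else (\<Sum>i\<le>n. x i) - class_index X n x)"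
      unfolding AffC by (auto simp: sum_subtractf[symmetric] intro!: sum.cong)
    ultimately show ?thesis
      using even sum0 by simp
  qed
  with solve_laplace_parity[of x n] have "even (?s n)" by simp
  then obtain h where h: "?s n = 2 * h" by (elim evenE)
  define c where "c = ?s(n := h)"
  have "x i = (\<Sum>j\<le>n. affine_cartan X n i j * c j)" if "i < n" for i
  proof (cases "i = 0")
    case True
    then show ?thesis
      using affine_first_row_sum[OF n, of c] AffC n2 by (simp add: c_def)
  next
    case False
    then show ?thesis
    proof (intro solve_laplace_row)
      show "affine_cartan X n i (i + 1) * c (i + 1) = - ?s (i + 1)"
        using False that AffC h by (auto simp: c_def simp del: solve_laplace.simps)
    qed (use that c_def AffC in auto)
  qed
  with affine_root_lattice_last_row[OF n level] show ?thesis by blast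
next
  case TwA
  then have n1: "1 \<le> n" using n by simp
  have "even (int (comark X n i) * x i)" if "i \<notin> {0}" for i
    using that TwA by auto
  then have "even (\<Sum>i\<in>{..n} - {0}. int (comark X n i) * x i)"
    by (intro dvd_sum) auto
  moreover have "(\<Sum>i\<le>n. int (comark X n i) * x i) =
      (\<Sum>i\<in>{..n} - {0}. int (comark X n i) * x i) + (\<Sum>i\<in>{0}. int (comark X n i) * x i)"
    by (intro sum.subset_diff) auto
  ultimately have "even (\<Sum>i\<in>{0}. int (comark X n i) * x i)"
    using level by presburger
  then have "even (x 0)" using TwA by simp
  then obtain b where b: "x 0 = 2 * b" by (elim evenE)
  \<comment> \<open>Row 0 fixes only the difference of the first two recurrence values. Starting at
    t, the end value of the solution started at 0, shifts that end value to 2 t, which can be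
    halved.\<close>
  define t where "t = solve_laplace x 0 (- b) n"
  let ?s = "solve_laplace x t (t - b)"
  have "?s n = 2 * t"
    using solve_laplace_shift[of x 0 t "- b" n] by (simp add: t_def)
  then obtain h where h: "?s n = 2 * h" by blast
  define c where "c = ?s(n := h)"
  have "x i = (\<Sum>j\<le>n. affine_cartan X n i j * c j)" if "i < n" for i
  proof (cases "i = 0")
    case True
    then show ?thesis
      using affine_first_row_sum[OF n, of c] TwA n1 b h by (cases "n = 1") (auto simp: c_def)
  next
    case False
    then show ?thesis
    proof (intro solve_laplace_row)
      show "affine_cartan X n i (i + 1) * c (i + 1) = - ?s (i + 1)"
        using False that TwA h by (auto simp: c_def simp del: solve_laplace.simps)
    qed (use that c_def TwA in auto)
  qed
  with affine_root_lattice_last_row[OF n level] show ?thesis by blast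
qed

lemma affine_root_lattice:
  fixes x :: "nat \<Rightarrow> int"
  assumes n: "min_rank X \<le> n"
  shows "(\<exists>c::nat \<Rightarrow> int. \<forall>i\<le>n. x i = (\<Sum>j\<le>n. affine_cartan X n i j * c j)) \<longleftrightarrow>
    (\<Sum>i\<le>n. int (comark X n i) * x i) = 0 \<and> even (class_index X n x)"
proof (intro iffI)
  assume "\<exists>c::nat \<Rightarrow> int. \<forall>i\<le>n. x i = (\<Sum>j\<le>n. affine_cartan X n i j * c j)"
  then obtain c :: "nat \<Rightarrow> int" where c: "\<forall>i\<le>n. x i = (\<Sum>j\<le>n. affine_cartan X n i j * c j)" ..
  then have "class_index X n x = class_index X n (\<lambda>i. \<Sum>j\<le>n. affine_cartan X n i j * c j)"
    by (cases X) (auto intro: sum.cong)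
  with c show "(\<Sum>i\<le>n. int (comark X n i) * x i) = 0 \<and> even (class_index X n x)"
    using affine_root_lattice_level[OF n, of c] affine_root_lattice_even[OF n, of c] by simp
qed (use affine_root_lattice_exists[OF n] in blast)

section \<open>Counting level classes\<close>

text \<open>The coroot values of \<open>(l - 1) \<Lambda>\<^sub>0 + \<Lambda>\<^sub>i\<close>, as
  integers because l - 1 may be -1.\<close>

definition distinguished_label :: "nat \<Rightarrow> nat \<Rightarrow> nat \<Rightarrow> int" where
  "distinguished_label l i j = (int l - 1) * (if j = 0 then 1 else 0) + (if j = i then 1 else 0)"

text \<open>For distinguished i these are, by \<open>affine_root_lattice\<close>, the nonnegative
  vectors congruent to the label modulo the root lattice.\<close>

definition level_class :: "affine_type \<Rightarrow> nat \<Rightarrow> nat \<Rightarrow> nat \<Rightarrow> (nat \<Rightarrow> nat) set" where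
  "level_class X n l i = {m. (\<forall>j>n. m j = 0) \<and> (\<Sum>j\<le>n. comark X n j * m j) = l \<and>
     even (class_index X n (\<lambda>j. int (m j) - distinguished_label l i j))}"

lemma sum_comark:
  shows "3 \<le> n \<Longrightarrow> (\<Sum>j\<le>n. comark AffB n j * m j) = m 0 + m 1 + m n + 2 * (\<Sum>j\<in>{2..<n}. m j)"
    and "(\<Sum>j\<le>n. comark TwA n j * m j) = m 0 + 2 * (\<Sum>j\<in>{1..n}. m j)"
    and "2 \<le> n \<Longrightarrow> (\<Sum>j\<le>n. comark TwD n j * m j) = m 0 + m n + 2 * (\<Sum>j\<in>{1..<n}. m j)"
proof -
  assume "3 \<le> n"
  then have "{..n} = {0, 1, n} \<union> {2..<n}" by auto
  then have "(\<Sum>j\<le>n. comark AffB n j * m j) =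
      (\<Sum>j\<in>{0, 1, n}. comark AffB n j * m j) + (\<Sum>j\<in>{2..<n}. comark AffB n j * m j)"
    by (simp only:) (rule sum.union_disjoint; auto)
  then show "(\<Sum>j\<le>n. comark AffB n j * m j) = m 0 + m 1 + m n + 2 * (\<Sum>j\<in>{2..<n}. m j)"
    using \<open>3 \<le> n\<close> by (simp add: sum_distrib_left)
next
  have "{..n} = {0} \<union> {1..n}" by auto
  then have "(\<Sum>j\<le>n. comark TwA n j * m j) =
      (\<Sum>j\<in>{0}. comark TwA n j * m j) + (\<Sum>j\<in>{1..n}. comark TwA n j * m j)"
    by (simp only:) (rule sum.union_disjoint; auto)
  then show "(\<Sum>j\<le>n. comark TwA n j * m j) = m 0 + 2 * (\<Sum>j\<in>{1..n}. m j)"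
    by (simp add: sum_distrib_left)
next
  assume "2 \<le> n"
  then have "{..n} = {0, n} \<union> {1..<n}" by auto
  then have "(\<Sum>j\<le>n. comark TwD n j * m j) =
      (\<Sum>j\<in>{0, n}. comark TwD n j * m j) + (\<Sum>j\<in>{1..<n}. comark TwD n j * m j)"
    by (simp only:) (rule sum.union_disjoint; auto)
  then show "(\<Sum>j\<le>n. comark TwD n j * m j) = m 0 + m n + 2 * (\<Sum>j\<in>{1..<n}. m j)"
    using \<open>2 \<le> n\<close> by (simp add: sum_distrib_left)
qed

text \<open>Brings \<open>l\<close> into the form that \<open>card_tuples_weighted\<close> expects;
  \<open>(l + d) mod 2\<close> is the parity of \<open>l - d\<close> and serves as a
  residue.\<close>

lemma split_parity:
  fixes d l :: nat
  assumes "d \<le> l"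
  shows "l = d + (l + d) mod 2 + 2 * ((l - d) div 2)"
proof -
  obtain k where k: "l = d + k" using assms le_Suc_ex by blast
  have parity: "(d + k + d) mod 2 = k mod 2" by presburger
  show ?thesis unfolding k parity by simp
qed

text \<open>The level forces the parity of m_0, since every other comark is 2.\<close>

lemma card_level_class_TwA:
  assumes "1 \<le> n"
  shows "finite (level_class TwA n l 0) \<and> card (level_class TwA n l 0) = (n + l div 2) choose n"
proof -
  define q where "q j = (if j = 0 then 2 else 1 :: nat)" for j :: nat
  define r where "r j = (if j = 0 then l mod 2 else 0 :: nat)" for j :: nat
  have R: "(\<Sum>j\<le>n. comark TwA n j * r j) = l mod 2"
    unfolding sum_comark by (simp add: r_def)
  have "level_class TwA n l 0 = {m. (\<forall>j>n. m j = 0) \<and> (\<Sum>j\<le>n. comark TwA n j * m j) = l \<and>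
      (\<forall>j\<le>n. m j mod q j = r j)}"
    unfolding level_class_def sum_comark by (auto simp: q_def r_def)
  then show ?thesis
    using card_tuples_weighted[of n "comark TwA n" q r l "l div 2"] R
    by (simp add: q_def r_def)
qed

text \<open>The class condition fixes m_n modulo 2 and the level then fixes m_0 modulo 2; all other
  comarks are 2.\<close>

lemma card_level_class_TwD:
  assumes n: "2 \<le> n" and i: "i \<in> {0, n}" and d: "d = (if i = n then 1 else 0)" "d \<le> l"
  shows "finite (level_class TwD n l i) \<and> card (level_class TwD n l i) = (n + (l - d) div 2) choose n"
proof -
  define q where "q j = (if j = 0 \<or> j = n then 2 else 1 :: nat)" for j :: nat
  define r where "r j = (if j = 0 then (l + d) mod 2 else if j = n then d else 0 :: nat)" for j :: nat
  have d2: "d < 2" using d by simp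
  have R: "(\<Sum>j\<le>n. comark TwD n j * r j) = (l + d) mod 2 + d"
    unfolding sum_comark(3)[OF n] using n by (simp add: r_def)
  have "(\<forall>j\<le>n. m j mod q j = r j) \<longleftrightarrow> even (class_index TwD n (\<lambda>j. int (m j) - distinguished_label l i j))"
    if "(\<Sum>j\<le>n. comark TwD n j * m j) = l" for m
  proof -
    have "distinguished_label l i n = int d"
      using n i d by (auto simp: distinguished_label_def)
    moreover have "even (int (m n) - int d) \<longleftrightarrow> m n mod 2 = d"
      using d2 by presburger
    ultimately have "even (class_index TwD n (\<lambda>j. int (m j) - distinguished_label l i j)) \<longleftrightarrow> m n mod 2 = d"
      by simp
    moreover have "(\<forall>j\<le>n. m j mod q j = r j) \<longleftrightarrow> m 0 mod 2 = (l + d) mod 2 \<and> m n mod 2 = d"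
    proof -
      have "m j mod q j = r j" if "j \<noteq> 0" "j \<noteq> n" for j
        using that by (simp add: q_def r_def)
      then have "(\<forall>j\<le>n. m j mod q j = r j) \<longleftrightarrow> m 0 mod q 0 = r 0 \<and> m n mod q n = r n"
        by (metis le0 order_refl)
      then show ?thesis using n by (simp add: q_def r_def)
    qed
    moreover have "m 0 mod 2 = (l + d) mod 2" if "m n mod 2 = d"
      using \<open>_ = l\<close>[symmetric] that[symmetric] unfolding sum_comark(3)[OF n]
      by (simp add: mod_2_eq_odd)
    ultimately show ?thesis by blast
  qed
  then have "level_class TwD n l i = {m. (\<forall>j>n. m j = 0) \<and> (\<Sum>j\<le>n. comark TwD n j * m j) = l \<and>
      (\<forall>j\<le>n. m j mod q j = r j)}"
    unfolding level_class_def by blast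
  moreover have "l = (l + d) mod 2 + d + 2 * ((l - d) div 2)"
    using split_parity[OF d(2)] by (simp add: ac_simps)
  ultimately show ?thesis
    using card_tuples_weighted[of n "comark TwD n" q r l "(l - d) div 2"] R d2
    by (simp add: q_def r_def)
qed

text \<open>Three vertices have comark 1. The class condition fixes m_n modulo 2, but the level
  fixes only m_0 + m_1 modulo 2. The parity a of m_0 is free, and its two values give the two
  binomials.\<close>

lemma card_level_class_AffB:
  assumes n: "3 \<le> n" and i: "i \<in> {0, n}" and d: "d = (if i = n then 1 else 0)" "d \<le> l"
  shows "finite (level_class AffB n l i) \<and> card (level_class AffB n l i) =
    ((n + (l - d) div 2) choose n) + (if d < l then (n + (l - 1 - d) div 2) choose n else 0)"
proof -
  define q where "q j = (if j \<le> 1 \<or> j = n then 2 else 1 :: nat)" for j :: nat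
  define r where "r a j = (if j = 0 then a else if j = 1 then (l + d + a) mod 2 else if j = n then d else 0 :: nat)"
    for a j :: nat
  define R where "R a = a + (l + d + a) mod 2 + d" for a
  define S where "S a = {m. (\<forall>j>n. m j = 0) \<and> (\<Sum>j\<le>n. comark AffB n j * m j) = l \<and>
      (\<forall>j\<le>n. m j mod q j = r a j)}" for a
  have d2: "d < 2" using d by simp
  have R: "R a = (\<Sum>j\<le>n. comark AffB n j * r a j)" for a
    unfolding sum_comark(1)[OF n] R_def using n by (simp add: r_def)
  have S: "finite (S a) \<and> card (S a) = (n + K) choose n" if "a < 2" "l = R a + 2 * K" for a K
    unfolding S_def by (rule card_tuples_weighted) (use n d2 that R in \<open>auto simp: q_def r_def\<close>)
  have "(\<exists>a<2. \<forall>j\<le>n. m j mod q j = r a j) \<longleftrightarrow>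
      even (class_index AffB n (\<lambda>j. int (m j) - distinguished_label l i j))"
    if "(\<Sum>j\<le>n. comark AffB n j * m j) = l" for m
  proof -
    have "distinguished_label l i n = int d"
      using n i d by (auto simp: distinguished_label_def)
    moreover have "even (int (m n) - int d) \<longleftrightarrow> m n mod 2 = d"
      using d2 by presburger
    ultimately have "even (class_index AffB n (\<lambda>j. int (m j) - distinguished_label l i j)) \<longleftrightarrow> m n mod 2 = d"
      by simp
    moreover have "(\<forall>j\<le>n. m j mod q j = r a j) \<longleftrightarrow>
        m 0 mod 2 = a \<and> m 1 mod 2 = (l + d + a) mod 2 \<and> m n mod 2 = d" for a
    proof -
      have "m j mod q j = r a j" if "j \<noteq> 0" "j \<noteq> 1" "j \<noteq> n" for j
        using that by (simp add: q_def r_def)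
      moreover have "1 \<le> n" using n by simp
      ultimately have "(\<forall>j\<le>n. m j mod q j = r a j) \<longleftrightarrow>
          m 0 mod q 0 = r a 0 \<and> m 1 mod q 1 = r a 1 \<and> m n mod q n = r a n"
        by (metis le0 order_refl)
      then show ?thesis using n by (simp add: q_def r_def)
    qed
    moreover have "m 1 mod 2 = (l + d + m 0 mod 2) mod 2" if "m n mod 2 = d"
      using \<open>_ = l\<close>[symmetric] that[symmetric] unfolding sum_comark(1)[OF n]
      by (simp add: mod_2_eq_odd)
    ultimately show ?thesis by auto
  qed
  then have "level_class AffB n l i = S 0 \<union> S 1"
    unfolding level_class_def S_def by (auto simp: less_2_cases_iff)
  moreover have "S 0 \<inter> S 1 = {}"
    by (auto simp: S_def r_def)
  moreover have "finite (S 0) \<and> card (S 0) = (n + (l - d) div 2) choose n"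
    by (rule S) (use split_parity[OF d(2)] in \<open>simp_all add: R_def ac_simps\<close>)
  moreover have "finite (S 1) \<and> card (S 1) = (if d < l then (n + (l - 1 - d) div 2) choose n else 0)"
  proof (cases "d < l")
    case True
    then have "l = R 1 + 2 * ((l - 1 - d) div 2)"
      using split_parity[of "Suc d" l] by (simp add: R_def ac_simps)
    with S[of 1 "(l - 1 - d) div 2"] True show ?thesis by simp
  next
    case False
    \<comment> \<open>Here l = d, while the residues for a = 1 already have level d + 2.\<close>
    with d(2) have "l < R 1" by (simp add: R_def)
    then have "S 1 = {}" unfolding R S_def by (rule tuples_weighted_empty)
    with False show ?thesis by simp
  qed
  ultimately show ?thesis
    by (simp add: card_Un_disjoint)
qed

text \<open>With sgn m = (-1)^(sum of the odd-indexed entries), 1 + (-1)^i * sgn m is 2 on the class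
  and 0 on the other compositions; summing gives twice the cardinality.\<close>

lemma card_level_class_AffC:
  assumes n: "2 \<le> n" and i: "i \<in> {0, 1}"
  shows "finite (level_class AffC n l i) \<and> 2 * int (card (level_class AffC n l i)) =
    int ((n + l) choose n) + (-1) ^ i * (if even (n * l) then int (((n + l) div 2) choose (n div 2)) else 0)"
proof -
  let ?sgn = "\<lambda>m. \<Prod>j\<le>n. ((-1) ^ j) ^ m j :: int"
  have label: "(\<Sum>j\<le>n. if odd j then distinguished_label l i j else 0) = int i"
  proof -
    have "(\<Sum>j\<le>n. if odd j then distinguished_label l i j else 0) = (\<Sum>j\<in>{i}. if odd j then distinguished_label l i j else 0)"
      by (rule sum_restrict) (use n i in \<open>auto simp: distinguished_label_def elim: oddE\<close>)
    with i show ?thesis by (auto simp: distinguished_label_def)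
  qed
  have sgn: "?sgn m = (-1) ^ (\<Sum>j\<le>n. if odd j then m j else 0)" for m
    unfolding power_sum by (intro prod.cong) auto
  have index: "class_index AffC n (\<lambda>j. int (m j) - distinguished_label l i j) =
      int (\<Sum>j\<le>n. if odd j then m j else 0) - int i" for m
  proof -
    have "class_index AffC n (\<lambda>j. int (m j) - distinguished_label l i j) =
       (\<Sum>j\<le>n. (if odd j then int (m j) else 0) - (if odd j then distinguished_label l i j else 0))"
      by (auto intro: sum.cong)
    then show ?thesis
      unfolding sum_subtractf label by (auto intro: sum.cong)
  qed
  have L: "level_class AffC n l i = {m \<in> tuples n l. even (class_index AffC n (\<lambda>j. int (m j) - distinguished_label l i j))}"
    by (auto simp: level_class_def tuples_def)
  have parity: "1 + (-1) ^ i * (-1) ^ N = (if even (int N - int i) then 2 else 0 :: int)" for N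
    by (cases "even N"; cases "even i") simp_all
  have *: "1 + (-1) ^ i * ?sgn m = (if m \<in> level_class AffC n l i then 2 else 0)" if "m \<in> tuples n l" for m
    using that unfolding L index sgn parity by simp
  have "int (card (tuples n l)) + (-1) ^ i * (\<Sum>m\<in>tuples n l. ?sgn m) = (\<Sum>m\<in>tuples n l. 1 + (-1) ^ i * ?sgn m)"
    by (simp add: sum.distrib sum_distrib_left)
  also have "\<dots> = (\<Sum>m\<in>tuples n l. if m \<in> level_class AffC n l i then 2 else 0)"
    using * by (intro sum.cong) auto
  also have "\<dots> = (\<Sum>m\<in>level_class AffC n l i. 2)"
    by (rule sum.mono_neutral_cong_right) (auto simp: finite_tuples L)
  finally show ?thesis
    unfolding signed_sum_tuples card_tuples using finite_tuples[of n l] by (simp add: L)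
qed

section \<open>Weights of highest weight modules\<close>

context affine_realization
begin

definition root_sum :: "(nat \<Rightarrow> int) \<Rightarrow> 'h \<Rightarrow> complex" where
  "root_sum c h = (\<Sum>i\<le>n. of_int (c i) * simple_root i h)"

lemma null_root_eq_root_sum: "null_root = root_sum (\<lambda>i. int (mark X n i))"
  by (simp add: fun_eq_iff null_root_def root_sum_def)

lemma root_sum_cong: "(\<And>i. i \<le> n \<Longrightarrow> c i = d i) \<Longrightarrow> root_sum c = root_sum d"
  by (auto simp: fun_eq_iff root_sum_def intro: sum.cong)

lemma root_sum_add: "root_sum (\<lambda>i. c i + d i) h = root_sum c h + root_sum d h"
  and root_sum_diff: "root_sum (\<lambda>i. c i - d i) h = root_sum c h - root_sum d h"
  by (simp_all add: root_sum_def algebra_simps sum.distrib sum_subtractf)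

lemma root_sum_zero: "root_sum (\<lambda>_. 0) = (\<lambda>_. 0)"
  by (simp add: root_sum_def fun_eq_iff)

lemma root_sum_Suc:
  assumes "i \<le> n"
  shows "root_sum (\<lambda>j. int ((c(i := Suc (c i))) j)) h = root_sum (\<lambda>j. int (c j)) h + simple_root i h"
proof -
  have "root_sum (\<lambda>j. int ((c(i := Suc (c i))) j)) h =
      root_sum (\<lambda>j. int (c j) + (if j = i then 1 else 0)) h"
    by (intro arg_cong[of _ _ "\<lambda>c. root_sum c h"]) auto
  also have "\<dots> = root_sum (\<lambda>j. int (c j)) h + root_sum (\<lambda>j. if j = i then 1 else 0) h"
    by (rule root_sum_add)
  also have "root_sum (\<lambda>j. if j = i then 1 else 0) h = (\<Sum>j\<le>n. if j = i then simple_root i h else 0)"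
    unfolding root_sum_def by (intro sum.cong) auto
  also have "\<dots> = simple_root i h"
    using assms by simp
  finally show ?thesis .
qed

lemma root_sum_inject:
  assumes eq: "root_sum c = root_sum d" and i: "i \<le> n"
  shows "c i = d i"
proof -
  have "root_sum (\<lambda>i. c i - d i) h = 0" for h
    using eq by (simp add: root_sum_diff)
  then have "of_int (c i - d i) = (0 :: complex)"
    using i unfolding root_sum_def by (rule simple_roots_independent)
  then show ?thesis by simp
qed

lemma root_sum_coroot:
  "i \<le> n \<Longrightarrow> root_sum c (coroot i) = of_int (\<Sum>j\<le>n. affine_cartan X n i j * c j)"
  by (simp add: root_sum_def simple_root_coroot mult.commute)

lemma linear_dual_iff:
  "Vector_Spaces.linear hscale (*) g \<longleftrightarrow>
    (\<forall>x y. g (x + y) = g x + g y) \<and> (\<forall>c x. g (hscale c x) = c * g x)"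
proof -
  have "vector_space ((*) :: complex \<Rightarrow> complex \<Rightarrow> complex)"
    by (unfold_locales) (simp_all add: algebra_simps)
  then show ?thesis
    by (simp add: Vector_Spaces.linear_iff H.vector_space_axioms)
qed

lemma root_sum_linear: "Vector_Spaces.linear hscale (*) (root_sum c)"
  using simple_root_linear
  by (simp add: linear_dual_iff root_sum_def sum.distrib[symmetric] sum_distrib_left algebra_simps)

end

context lie_module
begin

lemma act_add_right: "act x (v + w) = act x v + act x w"
  and act_scale_right: "act x (vscale c v) = vscale c (act x v)"
  and act_add_left: "act (x + y) v = act x v + act y v"
  and act_scale_left: "act (gscale c x) v = vscale c (act x v)"
  using act_linear_right act_linear_left unfolding Vector_Spaces.linear_iff by blast+

lemma act_zero_right: "act x 0 = 0"
  using act_add_right[of x 0 0] by simp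

lemma act_zero_left: "act 0 v = 0"
  using act_add_left[of 0 0 v] by simp

lemma act_sum_right: "act x (\<Sum>j\<in>F. w j) = (\<Sum>j\<in>F. act x (w j))"
  by (induction F rule: infinite_finite_induct) (simp_all add: act_zero_right act_add_right)

lemma subspace_act_preimage:
  "V.subspace W \<Longrightarrow> V.subspace {w. act x w \<in> W}"
  by (auto intro!: V.subspaceI simp: act_zero_right act_add_right act_scale_right
      V.subspace_0 V.subspace_add V.subspace_scale)

text \<open>Reduces invariance of a subspace under the whole algebra to its generators.\<close>

lemma subalgebra_stabilizer:
  assumes W: "V.subspace W"
  shows "subalgebra {x. \<forall>w\<in>W. act x w \<in> W}"
  unfolding subalgebra_def
proof (intro conjI ballI CollectI)
  show "subspace {x. \<forall>w\<in>W. act x w \<in> W}"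
    using W by (auto intro!: subspaceI simp: act_zero_left act_add_left act_scale_left
      V.subspace_0 V.subspace_add V.subspace_scale)
next
  fix x y w
  assume "x \<in> {x. \<forall>w\<in>W. act x w \<in> W}" "y \<in> {x. \<forall>w\<in>W. act x w \<in> W}" "w \<in> W"
  then show "act (bracket x y) w \<in> W"
    using W by (auto simp: act_bracket intro!: V.subspace_diff)
qed

end

context affine_module
begin

lemma weight_spaceD: "v \<in> weight_space \<mu> \<Longrightarrow> act (cart h) v = vscale (\<mu> h) v"
  by (simp add: weight_space_def)

lemma subspace_weight_space: "V.subspace (weight_space \<mu>)"
  unfolding weight_space_def
  by (rule V.subspaceI)
     (auto simp: act_zero_right act_add_right act_scale_right V.scale_right_distrib V.scale_left_commute)

lemma act_e_weight_space:
  assumes v: "v \<in> weight_space \<mu>" and i: "i \<le> n"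
  shows "act (e i) v \<in> weight_space (\<lambda>h. \<mu> h + simple_root i h)"
  unfolding weight_space_def
proof (intro CollectI allI)
  fix h
  have "vscale (simple_root i h) (act (e i) v) = act (bracket (cart h) (e i)) v"
    by (simp add: cart_e[OF i] act_scale_left)
  also have "\<dots> = act (cart h) (act (e i) v) - vscale (\<mu> h) (act (e i) v)"
    by (simp add: act_bracket weight_spaceD[OF v] act_scale_right)
  finally show "act (cart h) (act (e i) v) = vscale (\<mu> h + simple_root i h) (act (e i) v)"
    by (simp add: algebra_simps)
qed

lemma act_f_weight_space:
  assumes v: "v \<in> weight_space \<mu>" and i: "i \<le> n"
  shows "act (f i) v \<in> weight_space (\<lambda>h. \<mu> h - simple_root i h)"
  unfolding weight_space_def
proof (intro CollectI allI)
  fix h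
  have "vscale (- simple_root i h) (act (f i) v) = act (bracket (cart h) (f i)) v"
    by (simp only: cart_f[OF i] act_scale_left)
  also have "\<dots> = act (cart h) (act (f i) v) - vscale (\<mu> h) (act (f i) v)"
    by (simp add: act_bracket weight_spaceD[OF v] act_scale_right)
  finally show "act (cart h) (act (f i) v) = vscale (\<mu> h - simple_root i h) (act (f i) v)"
    by (simp add: algebra_simps)
qed

lemma act_e_act_f:
  assumes "i \<le> n" "j \<le> n"
  shows "act (e i) (act (f j) v) = act (f j) (act (e i) v) + (if i = j then act (cart (coroot i)) v else 0)"
  using act_bracket[of "e i" "f j" v] e_f[OF assms] by (auto simp: act_zero_left algebra_simps)

text \<open>Monomials in the \<open>f i\<close> applied to v; \<open>c\<close> counts the
  occurrences of each index and so determines the weight. They stand in for the enveloping algebra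
  of the negative part.\<close>

inductive lowered :: "'v \<Rightarrow> (nat \<Rightarrow> nat) \<Rightarrow> 'v \<Rightarrow> bool" for v where
  lowered_base: "lowered v (\<lambda>_. 0) v"
| lowered_step: "lowered v c w \<Longrightarrow> i \<le> n \<Longrightarrow> lowered v (c(i := Suc (c i))) (act (f i) w)"

lemma lowered_weight_space:
  assumes "lowered v c w" "v \<in> weight_space \<Lambda>"
  shows "w \<in> weight_space (\<lambda>h. \<Lambda> h - root_sum (\<lambda>j. int (c j)) h)"
  using assms
proof (induction rule: lowered.induct)
  case lowered_base
  then show ?case by (simp add: root_sum_zero)
next
  case (lowered_step c w i)
  from act_f_weight_space[OF lowered_step.IH[OF lowered_step.prems] lowered_step.hyps(2)]
  show ?case
    by (simp only: root_sum_Suc[OF lowered_step.hyps(2)] diff_diff_eq)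
qed

text \<open>\<open>cart\<close> acts by scalars on monomials and \<open>f i\<close> prolongs them.
  For \<open>e i\<close>, move it inwards through the monomial: each exchange leaves at most a
  \<open>cart\<close> term, and at the end v is killed.\<close>

lemma submodule_span_lowered:
  assumes v: "v \<in> weight_space \<Lambda>" and e_v: "\<And>i. i \<le> n \<Longrightarrow> act (e i) v = 0"
  shows "submodule (V.span {w. \<exists>c. lowered v c w})"
proof -
  let ?M = "{w. \<exists>c. lowered v c w}"
  let ?W = "V.span ?M"
  have W: "V.subspace ?W" by (rule V.subspace_span)
  have extend: "\<forall>w\<in>?W. act x w \<in> ?W" if "\<And>w. w \<in> ?M \<Longrightarrow> act x w \<in> ?W" for x
    using V.span_minimal[OF _ subspace_act_preimage[OF W], of ?M x] that by auto
  have cart: "\<forall>w\<in>?W. act (cart h) w \<in> ?W" for h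
  proof (rule extend)
    fix w assume "w \<in> ?M"
    then obtain c where "lowered v c w" by blast
    then have "act (cart h) w = vscale (\<Lambda> h - root_sum (\<lambda>j. int (c j)) h) w"
      using lowered_weight_space[OF _ v] weight_spaceD by blast
    then show "act (cart h) w \<in> ?W"
      using \<open>w \<in> ?M\<close> by (simp add: V.span_base V.span_scale)
  qed
  have f: "\<forall>w\<in>?W. act (f i) w \<in> ?W" if "i \<le> n" for i
    by (rule extend) (use that lowered_step in \<open>blast intro: V.span_base\<close>)
  have e: "\<forall>w\<in>?W. act (e i) w \<in> ?W" if i: "i \<le> n" for i
  proof (rule extend)
    fix w assume "w \<in> ?M"
    then obtain c where "lowered v c w" by blast
    then show "act (e i) w \<in> ?W"
    proof (induction rule: lowered.induct)
      case lowered_base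
      show ?case by (simp add: e_v i V.span_zero)
    next
      case (lowered_step c w j)
      then have "w \<in> ?W" by (blast intro: V.span_base)
      with lowered_step i show ?case
        using f[of j] cart by (auto simp: act_e_act_f intro!: V.span_add)
    qed
  qed
  have "generated_subalgebra (range cart \<union> e ` {..n} \<union> f ` {..n}) \<subseteq> {x. \<forall>w\<in>?W. act x w \<in> ?W}"
    unfolding generated_subalgebra_def
    using subalgebra_stabilizer[OF W] cart e f by (intro Inter_lower) auto
  then show ?thesis
    unfolding submodule_def generated using W by auto
qed

text \<open>Subtracting \<open>\<nu> k h\<close> from the action of \<open>cart h\<close>, with h
  separating \<open>\<mu>\<close> from \<open>\<nu> k\<close>, removes summand k and multiplies u by
  a nonzero scalar. The \<open>\<nu> j\<close> may coincide, as for monomials differing in the order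
  of factors.\<close>

lemma weight_vector_eq_sum:
  assumes "finite F"
    and "\<And>j. j \<in> F \<Longrightarrow> w j \<in> weight_space (\<nu> j)" "\<And>j. j \<in> F \<Longrightarrow> \<nu> j \<noteq> \<mu>"
    and "u \<in> weight_space \<mu>" "u = (\<Sum>j\<in>F. w j)"
  shows "u = 0"
  using assms
proof (induction F arbitrary: u w rule: finite_induct)
  case empty
  then show ?case by simp
next
  case (insert k F)
  then obtain h where h: "\<mu> h - \<nu> k h \<noteq> 0" by fastforce
  have "vscale (\<mu> h - \<nu> k h) u = act (cart h) u - vscale (\<nu> k h) u"
    using insert.prems(3) by (simp add: weight_spaceD V.scale_left_diff_distrib)
  also have "\<dots> = (\<Sum>j\<in>insert k F. act (cart h) (w j) - vscale (\<nu> k h) (w j))"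
    by (simp only: insert.prems(4) act_sum_right V.scale_sum_right sum_subtractf)
  also have "\<dots> = (\<Sum>j\<in>insert k F. vscale (\<nu> j h - \<nu> k h) (w j))"
    using insert.prems(1) by (intro sum.cong) (auto simp: weight_spaceD V.scale_left_diff_distrib)
  also have "\<dots> = (\<Sum>j\<in>F. vscale (\<nu> j h - \<nu> k h) (w j))"
    using insert.hyps by simp
  finally have eq: "vscale (\<mu> h - \<nu> k h) u = (\<Sum>j\<in>F. vscale (\<nu> j h - \<nu> k h) (w j))" .
  have "vscale (\<mu> h - \<nu> k h) u = 0"
  proof (rule insert.IH[OF _ _ _ eq])
    show "vscale (\<mu> h - \<nu> k h) u \<in> weight_space \<mu>"
      using insert.prems(3) subspace_weight_space by (rule V.subspace_scale[rotated])
    show "vscale (\<nu> j h - \<nu> k h) (w j) \<in> weight_space (\<nu> j)" if "j \<in> F" for j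
      using insert.prems(1)[of j] that subspace_weight_space by (intro V.subspace_scale) auto
  qed (use insert.prems(2) in auto)
  with h show ?case by simp
qed

lemma weight_below:
  assumes v: "v \<in> weight_space \<Lambda>" and span: "V.span {w. \<exists>c. lowered v c w} = UNIV"
    and u: "u \<in> weight_space \<mu>" "u \<noteq> 0"
  shows "\<exists>c :: nat \<Rightarrow> nat. \<mu> = (\<lambda>h. \<Lambda> h - root_sum (\<lambda>j. int (c j)) h)"
proof (rule ccontr)
  assume *: "\<not> ?thesis"
  have "u \<in> V.span {w. \<exists>c. lowered v c w}" by (simp add: span)
  then obtain F r where F: "finite F" "F \<subseteq> {w. \<exists>c. lowered v c w}" "u = (\<Sum>w\<in>F. vscale (r w) w)"
    unfolding V.span_explicit by blast
  then have "\<forall>w\<in>F. \<exists>c. lowered v c w" by blast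
  from bchoice[OF this] obtain c where c: "\<And>w. w \<in> F \<Longrightarrow> lowered v (c w) w" by blast
  have "u = 0"
  proof (rule weight_vector_eq_sum[OF F(1) _ _ u(1) F(3)])
    fix w assume "w \<in> F"
    then show "vscale (r w) w \<in> weight_space (\<lambda>h. \<Lambda> h - root_sum (\<lambda>j. int (c w j)) h)"
      using lowered_weight_space[OF c v] subspace_weight_space by (intro V.subspace_scale) auto
    show "(\<lambda>h. \<Lambda> h - root_sum (\<lambda>j. int (c w j)) h) \<noteq> \<mu>"
      using * by blast
  qed
  with u(2) show False ..
qed

section \<open>Strings in the direction of one simple root\<close>

lemma act_e_power_weight_space:
  assumes u: "u \<in> weight_space \<mu>" and i: "i \<le> n"
  shows "(act (e i) ^^ k) u \<in> weight_space (\<lambda>h. \<mu> h + of_nat k * simple_root i h)"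
proof (induction k)
  case 0
  with u show ?case by simp
next
  case (Suc k)
  from act_e_weight_space[OF this i] show ?case
    by (simp add: algebra_simps)
qed

text \<open>The j-th exchange of f and e subtracts \<open>\<mu> (coroot i)\<close> + 2 j; summed
  over j = 0, ..., k this is the stated product.\<close>

lemma act_f_act_e_power:
  assumes u: "u \<in> weight_space \<mu>" and i: "i \<le> n" and f_u: "act (f i) u = 0"
  shows "act (f i) ((act (e i) ^^ Suc k) u) =
    vscale (- (of_nat (Suc k) * (\<mu> (coroot i) + of_nat k))) ((act (e i) ^^ k) u)"
proof -
  have root: "simple_root i (coroot i) = 2"
    by (simp add: simple_root_coroot[OF i i] affine_cartan_diagonal)
  have swap: "act (f i) (act (e i) w) = act (e i) (act (f i) w) - act (cart (coroot i)) w" for w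
    using act_e_act_f[OF i i, of w] by simp
  have cart: "act (cart (coroot i)) ((act (e i) ^^ k) u) = vscale (\<mu> (coroot i) + 2 * of_nat k) ((act (e i) ^^ k) u)" for k
    using weight_spaceD[OF act_e_power_weight_space[OF u i]] by (simp add: root mult.commute)
  show ?thesis
  proof (induction k)
    case 0
    show ?case
      using cart[of 0] by (simp add: swap f_u act_zero_right)
  next
    case (Suc k)
    have "act (f i) ((act (e i) ^^ Suc (Suc k)) u) =
        act (e i) (act (f i) ((act (e i) ^^ Suc k) u)) - act (cart (coroot i)) ((act (e i) ^^ Suc k) u)"
      by (simp add: swap)
    also have "\<dots> = vscale (- (of_nat (Suc k) * (\<mu> (coroot i) + of_nat k)) - (\<mu> (coroot i) + 2 * of_nat (Suc k)))
        ((act (e i) ^^ Suc k) u)"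
      unfolding Suc cart act_scale_right by (simp add: V.scale_left_diff_distrib)
    finally show ?case by (simp add: algebra_simps)
  qed
qed

text \<open>A weight vector u of \<open>\<mu>\<close> is killed by \<open>f i\<close>. At the last
  power of \<open>e i\<close> that does not kill u, the scalar in \<open>act_f_act_e_power\<close>
  must vanish.\<close>

lemma weight_minus_simple_root:
  assumes below: "\<And>\<mu>. \<mu> \<in> weights \<Longrightarrow> \<exists>c :: nat \<Rightarrow> nat. \<mu> = (\<lambda>h. \<Lambda> h - root_sum (\<lambda>j. int (c j)) h)"
    and \<mu>: "\<mu> \<in> weights" and i: "i \<le> n"
    and no_weight: "(\<lambda>h. \<mu> h - simple_root i h) \<notin> weights"
  shows "\<exists>k. \<mu> (coroot i) = - of_nat k"
proof -
  have lin: "Vector_Spaces.linear hscale (*) (\<lambda>h. \<mu> h + of_nat k * simple_root i h)"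
      "Vector_Spaces.linear hscale (*) (\<lambda>h. \<mu> h - simple_root i h)" for k
    using \<mu> simple_root_linear[OF i] unfolding weights_def by (auto simp: linear_dual_iff algebra_simps)
  obtain u where u: "u \<in> weight_space \<mu>" "u \<noteq> 0"
    using \<mu> V.subspace_0[OF subspace_weight_space] unfolding weights_def by blast
  have "act (f i) u \<in> weight_space (\<lambda>h. \<mu> h - simple_root i h)"
    using act_f_weight_space[OF u(1) i] .
  with no_weight lin(2) have f_u: "act (f i) u = 0"
    unfolding weights_def by blast
  obtain c :: "nat \<Rightarrow> nat" where c: "\<mu> = (\<lambda>h. \<Lambda> h - root_sum (\<lambda>j. int (c j)) h)"
    using below[OF \<mu>] by blast
  \<comment> \<open>After \<open>c i + 1\<close> raisings the coefficient of simple root i would be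
    negative, against \<open>below\<close>.\<close>
  define N where "N = Suc (c i)"
  have "(act (e i) ^^ N) u = 0"
  proof (rule ccontr)
    assume "(act (e i) ^^ N) u \<noteq> 0"
    with act_e_power_weight_space[OF u(1) i, of N] lin(1)
    have "(\<lambda>h. \<mu> h + of_nat N * simple_root i h) \<in> weights"
      unfolding weights_def by blast
    from below[OF this] obtain c' :: "nat \<Rightarrow> nat"
      where c': "(\<lambda>h. \<mu> h + of_nat N * simple_root i h) = (\<lambda>h. \<Lambda> h - root_sum (\<lambda>j. int (c' j)) h)" ..
    have "of_nat N * simple_root i h = root_sum (\<lambda>j. if j = i then int N else 0) h" for h
    proof -
      have "root_sum (\<lambda>j. if j = i then int N else 0) h = (\<Sum>j\<le>n. if j = i then of_nat N * simple_root i h else 0)"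
        unfolding root_sum_def by (intro sum.cong) auto
      then show ?thesis using i by simp
    qed
    then have "root_sum (\<lambda>j. int (c j)) h = root_sum (\<lambda>j. int (c' j) + (if j = i then int N else 0)) h" for h
      using fun_cong[OF c', of h] unfolding root_sum_add c by (simp add: algebra_simps)
    from root_sum_inject[OF ext[OF this] i] show False
      by (simp add: N_def)
  qed
  moreover have "(act (e i) ^^ 0) u \<noteq> 0"
    using u by simp
  ultimately obtain k where k: "(act (e i) ^^ k) u \<noteq> 0" "(act (e i) ^^ Suc k) u = 0"
    using ex_least_nat_less[of "\<lambda>k. (act (e i) ^^ k) u = 0" N] by blast
  from act_f_act_e_power[OF u(1) i f_u, of k] k
  have "of_nat (Suc k) * (\<mu> (coroot i) + of_nat k) = 0"
    by (simp del: of_nat_Suc add: act_zero_right)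
  then have "\<mu> (coroot i) + of_nat k = 0"
    by (simp del: of_nat_Suc)
  then show ?thesis
    by (auto simp: eq_neg_iff_add_eq_0)
qed

text \<open>
  Among the weights \<open>\<Lambda> - \<beta>\<close> with \<open>\<beta> \<le> \<alpha>\<close> take one with \<open>\<beta>\<close> as large as possible. Where \<open>\<beta>\<close> is still
  smaller than \<open>\<alpha>\<close> this weight cannot be lowered further, so it is nonpositive on the corresponding
  coroots, and the maximum principle applies to \<open>\<alpha> - \<beta>\<close>.
\<close>

lemma dominant_weight:
  assumes below: "\<And>\<mu>. \<mu> \<in> weights \<Longrightarrow> \<exists>c :: nat \<Rightarrow> nat. \<mu> = (\<lambda>h. \<Lambda> h - root_sum (\<lambda>j. int (c j)) h)"
    and \<Lambda>: "\<Lambda> \<in> weights"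
    and dominant: "\<And>i. i \<le> n \<Longrightarrow> \<Lambda> (coroot i) - root_sum (\<lambda>j. int (c j)) (coroot i) = of_nat (m i)"
    and nonzero: "k \<le> n" "m k \<noteq> 0"
  shows "(\<lambda>h. \<Lambda> h - root_sum (\<lambda>j. int (c j)) h) \<in> weights"
proof -
  define P where "P b \<longleftrightarrow> (\<forall>i\<le>n. b i \<le> c i) \<and> (\<lambda>h. \<Lambda> h - root_sum (\<lambda>j. int (b j)) h) \<in> weights" for b
  have "P (\<lambda>_. 0)" using \<Lambda> by (simp add: P_def root_sum_zero)
  moreover have "\<forall>b. P b \<longrightarrow> (\<Sum>i\<le>n. b i) < Suc (\<Sum>i\<le>n. c i)"
    unfolding P_def less_Suc_eq_le by (intro allI impI sum_mono) simp
  ultimately have "\<exists>b. P b \<and> (\<forall>b'. P b' \<longrightarrow> (\<Sum>i\<le>n. b' i) \<le> (\<Sum>i\<le>n. b i))"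
    by (rule ex_has_greatest_nat[of P _ "\<lambda>b. \<Sum>i\<le>n. b i"])
  then obtain b where Pb: "P b" and max: "\<And>b'. P b' \<Longrightarrow> (\<Sum>i\<le>n. b' i) \<le> (\<Sum>i\<le>n. b i)"
    by blast
  note b = Pb[unfolded P_def]
  define u where "u i = int (c i) - int (b i)" for i
  have u_nonneg: "u i \<ge> 0" if "i \<le> n" for i
    using b that by (simp add: u_def)
  have Au: "\<exists>p. (\<Sum>j\<le>n. affine_cartan X n i j * u j) = - int p - int (m i)" if i: "i \<le> n" "u i > 0" for i
  proof -
    have "(\<lambda>h. \<Lambda> h - root_sum (\<lambda>j. int (b j)) h - simple_root i h) \<notin> weights"
    proof
      assume "(\<lambda>h. \<Lambda> h - root_sum (\<lambda>j. int (b j)) h - simple_root i h) \<in> weights"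
      then have "P (b(i := Suc (b i)))"
        using b i unfolding P_def root_sum_Suc[OF i(1)] by (simp add: u_def diff_diff_eq)
      from max[OF this] have "(\<Sum>j\<le>n. (b(i := Suc (b i))) j) \<le> (\<Sum>j\<le>n. b j)" .
      moreover have "(\<Sum>j\<le>n. (b(i := Suc (b i))) j) > (\<Sum>j\<le>n. b j)"
        by (rule sum_strict_mono_ex1) (use i in auto)
      ultimately show False by simp
    qed
    from weight_minus_simple_root[OF below conjunct2[OF b] i(1) this]
    obtain p where p: "\<Lambda> (coroot i) - root_sum (\<lambda>j. int (b j)) (coroot i) = - of_nat p" by blast
    have "of_int (\<Sum>j\<le>n. affine_cartan X n i j * u j) = root_sum u (coroot i)"
      by (simp only: root_sum_coroot[OF i(1)])
    also have "\<dots> = root_sum (\<lambda>j. int (c j)) (coroot i) - root_sum (\<lambda>j. int (b j)) (coroot i)"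
      unfolding u_def by (rule root_sum_diff)
    also have "\<dots> = of_int (- int p - int (m i))"
      using p dominant[OF i(1)] by (simp add: algebra_simps)
    finally show ?thesis unfolding of_int_eq_iff by blast
  qed
  have "u i = 0" if i: "i \<le> n" for i
  proof (rule ccontr)
    assume "u i \<noteq> 0"
    then have "u i > 0" using u_nonneg[OF i] by simp
    then obtain t where t: "t > 0" "\<forall>i\<le>n. u i = t * int (mark X n i)"
      using affine_maximum_principle[OF rank i, of u] Au by fastforce
    have "u k > 0"
      using t nonzero(1) mark_pos[of X n k] by simp
    from Au[OF nonzero(1) this] obtain p
      where p: "(\<Sum>j\<le>n. affine_cartan X n k j * u j) = - int p - int (m k)" by blast
    \<comment> \<open>A multiple of the marks is killed by the matrix, whereas row \<open>k\<close>
      has the negative value - p - m k.\<close>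
    have "(\<Sum>j\<le>n. affine_cartan X n k j * u j) = t * (\<Sum>j\<le>n. affine_cartan X n k j * int (mark X n j))"
      using t(2) by (simp add: sum_distrib_left algebra_simps)
    with p nonzero(2) mark_comark_null[OF rank nonzero(1)] show False by simp
  qed
  then have "root_sum (\<lambda>j. int (c j)) = root_sum (\<lambda>j. int (b j))"
    by (intro root_sum_cong) (simp add: u_def)
  with b show ?thesis by simp
qed

end

context irreducible_highest_weight_module
begin

lemma obtain_highest_weight_vector:
  obtains v where "v \<noteq> 0" "v \<in> weight_space \<Lambda>" "\<And>i. i \<le> n \<Longrightarrow> act (e i) v = 0"
    "V.span {w. \<exists>c. lowered v c w} = UNIV"
proof -
  obtain v where v: "v \<noteq> 0" "v \<in> weight_space \<Lambda>" "\<And>x. x \<in> n_plus \<Longrightarrow> act x v = 0"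
      "generated_submodule {v} = UNIV"
    using highest_weight unfolding highest_weight_module_def by blast
  have "e i \<in> n_plus" if "i \<le> n" for i
    using that unfolding n_plus_def generated_subalgebra_def by blast
  with v have e: "\<And>i. i \<le> n \<Longrightarrow> act (e i) v = 0" by blast
  have "v \<in> V.span {w. \<exists>c. lowered v c w}"
    by (rule V.span_base) (blast intro: lowered_base)
  then have "generated_submodule {v} \<subseteq> V.span {w. \<exists>c. lowered v c w}"
    unfolding generated_submodule_def using submodule_span_lowered[OF v(2) e] by blast
  with v that[OF v(1,2) e] show ?thesis by blast
qed

lemma weights_below: "\<mu> \<in> weights \<Longrightarrow> \<exists>c :: nat \<Rightarrow> nat. \<mu> = (\<lambda>h. \<Lambda> h - root_sum (\<lambda>j. int (c j)) h)"
proof -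
  assume "\<mu> \<in> weights"
  then obtain u where u: "u \<in> weight_space \<mu>" "u \<noteq> 0"
    using V.subspace_0[OF subspace_weight_space] unfolding weights_def by blast
  obtain v where v: "v \<in> weight_space \<Lambda>" "V.span {w. \<exists>c. lowered v c w} = UNIV"
    by (rule obtain_highest_weight_vector) blast
  show ?thesis by (rule weight_below[OF v u])
qed

lemma highest_weight_in_weights:
  assumes "Vector_Spaces.linear hscale (*) \<Lambda>"
  shows "\<Lambda> \<in> weights"
  using assms obtain_highest_weight_vector unfolding weights_def by blast

text \<open>
  For \<open>\<Lambda> = 0\<close> each \<open>f\<^sub>i v\<close> is again annihilated by all \<open>e\<^sub>j\<close>. If it were nonzero it would
  generate the irreducible module from below \<open>v\<close>.
\<close>

lemma weights_trivial:
  assumes zero: "\<And>i. i \<le> n \<Longrightarrow> \<Lambda> (coroot i) = 0" and \<mu>: "\<mu> \<in> weights"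
  shows "\<mu> = \<Lambda>"
proof -
  obtain v where v: "v \<noteq> 0" "v \<in> weight_space \<Lambda>" and e: "\<And>i. i \<le> n \<Longrightarrow> act (e i) v = 0"
    and span: "V.span {w. \<exists>c. lowered v c w} = UNIV"
    by (rule obtain_highest_weight_vector) blast
  have f: "act (f i) v = 0" if i: "i \<le> n" for i
  proof (rule ccontr)
    assume nz: "act (f i) v \<noteq> 0"
    let ?W = "V.span {w. \<exists>c. lowered (act (f i) v) c w}"
    have wt: "act (f i) v \<in> weight_space (\<lambda>h. \<Lambda> h - simple_root i h)"
      by (rule act_f_weight_space[OF v(2) i])
    have "act (e j) (act (f i) v) = 0" if "j \<le> n" for j
      using that i e zero weight_spaceD[OF v(2)] by (simp add: act_e_act_f act_zero_right)
    with wt have "submodule ?W" by (rule submodule_span_lowered)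
    moreover have "act (f i) v \<in> ?W"
      by (rule V.span_base) (blast intro: lowered_base)
    ultimately have "?W = UNIV"
      using irreducible nz unfolding irreducible_module_def by blast
    from weight_below[OF wt this v(2,1)] obtain c :: "nat \<Rightarrow> nat"
      where c: "\<Lambda> = (\<lambda>h. \<Lambda> h - simple_root i h - root_sum (\<lambda>j. int (c j)) h)" by blast
    have "root_sum (\<lambda>j. int ((c(i := Suc (c i))) j)) h = root_sum (\<lambda>_. 0) h" for h
      unfolding root_sum_Suc[OF i] root_sum_zero using fun_cong[OF c, of h] by (simp add: algebra_simps)
    from root_sum_inject[OF ext[OF this] i] show False by simp
  qed
  have low: "w = 0 \<or> w = v" if "lowered v c w" for c w
    using that by (induction rule: lowered.induct) (auto simp: f act_zero_right)
  obtain u where u: "u \<in> weight_space \<mu>" "u \<noteq> 0"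
    using \<mu> V.subspace_0[OF subspace_weight_space] unfolding weights_def by blast
  have "V.span {w. \<exists>c. lowered v c w} \<subseteq> weight_space \<Lambda>"
    using low v(2) V.subspace_0[OF subspace_weight_space]
    by (intro V.span_minimal subspace_weight_space) blast
  with span have "u \<in> weight_space \<Lambda>" by blast
  from weight_spaceD[OF this] have "vscale (\<Lambda> h) u = vscale (\<mu> h) u" for h
    by (simp only: weight_spaceD[OF u(1)])
  with u(2) show "\<mu> = \<Lambda>" by (simp add: fun_eq_iff)
qed

end

section \<open>Dominant maximal weights\<close>

context affine_realization
begin

lemma null_root_coroot: "i \<le> n \<Longrightarrow> null_root (coroot i) = 0"
  using mark_comark_null[OF rank] by (simp add: null_root_eq_root_sum root_sum_coroot del: of_int_sum)

definition coroot_values :: "('h \<Rightarrow> complex) \<Rightarrow> nat \<Rightarrow> nat" where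
  "coroot_values \<mu> j = (if j \<le> n then nat \<lfloor>Re (\<mu> (coroot j))\<rfloor> else 0)"

lemma coroot_values_eq:
  "dominant_integral \<mu> \<Longrightarrow> j \<le> n \<Longrightarrow> \<mu> (coroot j) = of_nat (coroot_values \<mu> j)"
  by (auto simp: dominant_integral_def coroot_values_def elim!: allE Nats_cases)

end

context irreducible_highest_weight_module
begin

text \<open>If t were positive, \<open>\<mu>\<close> plus the null root would have the coefficients
  \<open>c' i + (t - 1) * mark X n i\<close>, still nonnegative. Its coroot values are those of
  \<open>\<mu>\<close>, so \<open>dominant_weight\<close> would make it a weight, against
  maximality.\<close>

lemma maximal_weight_coefficients:
  assumes \<mu>: "\<mu> \<in> maximal_weights" "\<mu> = (\<lambda>h. \<Lambda> h - root_sum (\<lambda>j. int (c j)) h)"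
    and dominant: "dominant_integral \<mu>" "k \<le> n" "coroot_values \<mu> k \<noteq> 0"
    and lin: "Vector_Spaces.linear hscale (*) \<Lambda>"
    and t: "\<And>i. i \<le> n \<Longrightarrow> int (c i) = int (c' i) + t * int (mark X n i)"
  shows "t \<le> 0"
proof (rule ccontr)
  assume "\<not> t \<le> 0"
  define d where "d i = c' i + nat (t - 1) * mark X n i" for i
  have "int (d i) = int (c i) - int (mark X n i)" if "i \<le> n" for i
    using t[OF that] \<open>\<not> t \<le> 0\<close> by (simp add: d_def algebra_simps)
  then have "root_sum (\<lambda>i. int (d i)) = root_sum (\<lambda>i. int (c i) - int (mark X n i))"
    by (rule root_sum_cong)
  then have d: "root_sum (\<lambda>i. int (d i)) h = root_sum (\<lambda>i. int (c i)) h - null_root h" for h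
    by (simp only: null_root_eq_root_sum root_sum_diff)
  have "(\<lambda>h. \<Lambda> h - root_sum (\<lambda>j. int (d j)) h) \<in> weights"
  proof (rule dominant_weight[where m = "coroot_values \<mu>" and k = k, OF weights_below highest_weight_in_weights[OF lin] _ dominant(2,3)])
    fix i assume "i \<le> n"
    then show "\<Lambda> (coroot i) - root_sum (\<lambda>j. int (d j)) (coroot i) = of_nat (coroot_values \<mu> i)"
      unfolding d null_root_coroot[OF \<open>i \<le> n\<close>] coroot_values_eq[OF dominant(1) \<open>i \<le> n\<close>, symmetric]
      by (simp add: \<mu>(2))
  qed
  also have "(\<lambda>h. \<Lambda> h - root_sum (\<lambda>j. int (d j)) h) = (\<lambda>h. \<mu> h + null_root h)"
    by (simp add: d \<mu>(2) fun_eq_iff)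
  finally show False
    using \<mu>(1) by (simp add: maximal_weights_def)
qed

section \<open>Coroot values as a bijection onto a level class\<close>

context
  fixes L :: "nat \<Rightarrow> int" and l :: nat
  assumes lin: "Vector_Spaces.linear hscale (*) \<Lambda>"
    and label: "\<And>j. j \<le> n \<Longrightarrow> \<Lambda> (coroot j) = of_int (L j)"
    and level: "(\<Sum>j\<le>n. int (comark X n j) * L j) = int l"
    and level_0: "\<And>j. l = 0 \<Longrightarrow> j \<le> n \<Longrightarrow> L j = 0"
begin

lemma coroot_values_root_sum:
  assumes "dominant_integral \<mu>" "\<mu> = (\<lambda>h. \<Lambda> h - root_sum c h)" and j: "j \<le> n"
  shows "int (coroot_values \<mu> j) = L j - (\<Sum>k\<le>n. affine_cartan X n j k * c k)"
proof -
  have "(of_int (int (coroot_values \<mu> j)) :: complex) = of_int (L j - (\<Sum>k\<le>n. affine_cartan X n j k * c k))"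
    using coroot_values_eq[OF assms(1) j] unfolding assms(2)
    by (simp only: label[OF j] root_sum_coroot[OF j] of_int_diff of_int_of_nat_eq)
  then show ?thesis by (simp only: of_int_eq_iff)
qed

lemma positive_level_nonzero:
  assumes "(\<Sum>j\<le>n. comark X n j * m j) = l" "l \<noteq> 0"
  shows "\<exists>k\<le>n. m k \<noteq> 0"
proof (rule ccontr)
  assume "\<not> ?thesis"
  then have "(\<Sum>j\<le>n. comark X n j * m j) = 0" by simp
  with assms show False by simp
qed

lemma coroot_values_mem:
  assumes "\<mu> \<in> dominant_maximal_weights"
  shows "(\<forall>j>n. coroot_values \<mu> j = 0) \<and> (\<Sum>j\<le>n. comark X n j * coroot_values \<mu> j) = l \<and>
    even (class_index X n (\<lambda>j. int (coroot_values \<mu> j) - L j))"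
proof -
  have \<mu>: "\<mu> \<in> weights" "dominant_integral \<mu>"
    using assms by (auto simp: dominant_maximal_weights_def maximal_weights_def)
  obtain c :: "nat \<Rightarrow> nat" where c: "\<mu> = (\<lambda>h. \<Lambda> h - root_sum (\<lambda>j. int (c j)) h)"
    using weights_below[OF \<mu>(1)] by blast
  have "int (coroot_values \<mu> j) - L j = (\<Sum>k\<le>n. affine_cartan X n j k * - int (c k))" if "j \<le> n" for j
    using coroot_values_root_sum[OF \<mu>(2) c that] by (simp add: sum_negf)
  then have "\<exists>a :: nat \<Rightarrow> int. \<forall>j\<le>n. int (coroot_values \<mu> j) - L j = (\<Sum>k\<le>n. affine_cartan X n j k * a k)"
    by (intro exI[of _ "\<lambda>k. - int (c k)"] allI impI)
  then have *: "(\<Sum>j\<le>n. int (comark X n j) * (int (coroot_values \<mu> j) - L j)) = 0"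
      "even (class_index X n (\<lambda>j. int (coroot_values \<mu> j) - L j))"
    unfolding affine_root_lattice[OF rank] by simp_all
  from *(1) have "int (\<Sum>j\<le>n. comark X n j * coroot_values \<mu> j) = int l"
    using level by (simp add: right_diff_distrib sum_subtractf)
  with *(2) show ?thesis
    unfolding of_nat_eq_iff by (simp add: coroot_values_def)
qed

text \<open>At positive level, equal coroot values put the difference of the coefficients into the
  kernel, so the weights differ by t null roots; maximality of either weight excludes one sign of
  t.\<close>

lemma inj_on_coroot_values: "inj_on coroot_values dominant_maximal_weights"
proof (rule inj_onI)
  fix \<mu> \<mu>'
  assume \<mu>: "\<mu> \<in> dominant_maximal_weights" and \<mu>': "\<mu>' \<in> dominant_maximal_weights"
    and eq: "coroot_values \<mu> = coroot_values \<mu>'"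
  have wt: "\<mu> \<in> weights" "\<mu>' \<in> weights" "\<mu> \<in> maximal_weights" "\<mu>' \<in> maximal_weights"
      "dominant_integral \<mu>" "dominant_integral \<mu>'"
    using \<mu> \<mu>' by (auto simp: dominant_maximal_weights_def maximal_weights_def)
  show "\<mu> = \<mu>'"
  proof (cases "l = 0")
    case True
    then have "\<nu> = \<Lambda>" if "\<nu> \<in> weights" for \<nu>
      using that by (intro weights_trivial) (simp add: label level_0)
    with wt show ?thesis by metis
  next
    case False
    obtain k where k: "k \<le> n" "coroot_values \<mu> k \<noteq> 0" "coroot_values \<mu>' k \<noteq> 0"
      using positive_level_nonzero[OF _ False] coroot_values_mem[OF \<mu>] eq by metis
    obtain c c' :: "nat \<Rightarrow> nat" where c: "\<mu> = (\<lambda>h. \<Lambda> h - root_sum (\<lambda>j. int (c j)) h)"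
        "\<mu>' = (\<lambda>h. \<Lambda> h - root_sum (\<lambda>j. int (c' j)) h)"
      using weights_below wt(1,2) by blast
    have "(\<Sum>k\<le>n. affine_cartan X n j k * (int (c k) - int (c' k))) = 0" if "j \<le> n" for j
      using coroot_values_root_sum[OF wt(5) c(1) that] coroot_values_root_sum[OF wt(6) c(2) that] eq
      by (simp add: right_diff_distrib sum_subtractf)
    then obtain t where t: "\<forall>i\<le>n. int (c i) - int (c' i) = t * int (mark X n i)"
      using affine_kernel[OF rank, of "\<lambda>k. int (c k) - int (c' k)"] by blast
    have "t \<le> 0"
      by (rule maximal_weight_coefficients[OF wt(3) c(1) wt(5) k(1,2) lin, where c' = c'])
         (use t in \<open>simp add: algebra_simps\<close>)
    moreover have "- t \<le> 0"
      by (rule maximal_weight_coefficients[OF wt(4) c(2) wt(6) k(1,3) lin, where c' = c])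
         (use t in \<open>simp add: algebra_simps\<close>)
    ultimately have "\<forall>i\<le>n. int (c i) = int (c' i)" using t by simp
    then have "root_sum (\<lambda>j. int (c j)) = root_sum (\<lambda>j. int (c' j))"
      by (intro root_sum_cong) simp
    then show ?thesis by (simp add: c)
  qed
qed

text \<open>At positive level, a solution of A a = m - L yields candidates with coefficients t times
  the marks minus a, all with coroot values m. The least t keeping them nonnegative gives the
  maximal weight.\<close>

lemma coroot_values_surj:
  assumes m: "\<forall>j>n. m j = 0" "(\<Sum>j\<le>n. comark X n j * m j) = l"
    "even (class_index X n (\<lambda>j. int (m j) - L j))"
  shows "\<exists>\<mu>\<in>dominant_maximal_weights. coroot_values \<mu> = m"
proof -
  have "\<exists>\<mu>\<in>maximal_weights. \<forall>j\<le>n. \<mu> (coroot j) = of_nat (m j)"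
  proof (cases "l = 0")
    case True
    then have zero: "\<Lambda> (coroot j) = 0" if "j \<le> n" for j
      using that by (simp add: label level_0)
    obtain p where p: "p \<le> n" "mark X n p = 1" using mark_coprime by blast
    \<comment> \<open>\<open>\<Lambda>\<close> is the only weight here, and the null root is nonzero
      by independence of the simple roots.\<close>
    have "(\<lambda>h. \<Lambda> h + null_root h) \<notin> weights"
    proof
      assume "(\<lambda>h. \<Lambda> h + null_root h) \<in> weights"
      from weights_trivial[OF zero this] have "root_sum (\<lambda>i. int (mark X n i)) = root_sum (\<lambda>_. 0)"
        unfolding root_sum_zero null_root_eq_root_sum by (simp add: fun_eq_iff)
      from root_sum_inject[OF this p(1)] p(2) show False by simp
    qed
    moreover have "m j = 0" if "j \<le> n" for j
      using m(2) True that comark_pos[of X n j] by (auto dest: bspec[of _ _ j])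
    ultimately show ?thesis
      using highest_weight_in_weights[OF lin] zero by (auto simp: maximal_weights_def)
  next
    case False
    have "(\<Sum>j\<le>n. int (comark X n j) * (int (m j) - L j)) = 0"
      using level m(2) by (simp add: right_diff_distrib sum_subtractf flip: of_nat_mult of_nat_sum)
    then obtain a :: "nat \<Rightarrow> int" where a: "\<forall>i\<le>n. int (m i) - L i = (\<Sum>j\<le>n. affine_cartan X n i j * a j)"
      using affine_root_lattice[OF rank, of "\<lambda>j. int (m j) - L j"] m(3) by blast
    \<comment> \<open>\<open>K\<close> bounds all \<open>a i\<close>, so t = K is admissible; s
      measures how far t can be lowered.\<close>
    define K where "K = (\<Sum>i\<le>n. \<bar>a i\<bar>)"
    define Q where "Q s \<longleftrightarrow> (\<forall>i\<le>n. 0 \<le> (K - int s) * int (mark X n i) - a i)" for s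
    obtain p where p: "p \<le> n" "mark X n p = 1" using mark_coprime by blast
    have "Q 0"
      unfolding Q_def
    proof (intro allI impI)
      fix i assume "i \<le> n"
      then have "\<bar>a i\<bar> \<le> K" unfolding K_def by (intro member_le_sum) auto
      also have "K * 1 \<le> K * int (mark X n i)"
        using mark_pos[of X n i] by (intro mult_left_mono) (auto simp: K_def intro: sum_nonneg)
      finally show "0 \<le> (K - int 0) * int (mark X n i) - a i" by simp
    qed
    \<comment> \<open>At a vertex p of mark 1, \<open>Q s\<close> bounds s by K - a p, so a largest
      s exists.\<close>
    moreover have "\<forall>s. Q s \<longrightarrow> s < Suc (nat (K - a p))"
      unfolding Q_def using p by (auto simp: less_Suc_eq_le)
    ultimately obtain s where s: "Q s" "\<forall>s'. Q s' \<longrightarrow> s' \<le> s"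
      using ex_has_greatest_nat[of Q 0 "\<lambda>s. s"] by blast
    define c where "c i = nat ((K - int s) * int (mark X n i) - a i)" for i
    have c: "int (c i) = (K - int s) * int (mark X n i) - a i" if "i \<le> n" for i
      using s(1) that by (simp add: Q_def c_def)
    define \<mu> where "\<mu> = (\<lambda>h. \<Lambda> h - root_sum (\<lambda>j. int (c j)) h)"
    have val: "\<Lambda> (coroot i) - root_sum (\<lambda>j. int (c j)) (coroot i) = of_nat (m i)" if i: "i \<le> n" for i
    proof -
      have "(\<Sum>j\<le>n. affine_cartan X n i j * int (c j)) =
          (\<Sum>j\<le>n. affine_cartan X n i j * ((K - int s) * int (mark X n j) - a j))"
        by (intro sum.cong) (auto simp: c)
      also have "\<dots> = (K - int s) * (\<Sum>j\<le>n. affine_cartan X n i j * int (mark X n j)) -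
          (\<Sum>j\<le>n. affine_cartan X n i j * a j)"
        by (simp add: right_diff_distrib sum_subtractf sum_distrib_left mult.left_commute)
      also have "\<dots> = L i - int (m i)"
        using mark_comark_null[OF rank i] a[rule_format, OF i] by simp
      finally show ?thesis
        by (simp add: root_sum_coroot[OF i] label[OF i] del: of_int_sum)
    qed
    obtain k where k: "k \<le> n" "m k \<noteq> 0"
      using positive_level_nonzero[OF m(2) False] by blast
    have "\<mu> \<in> weights"
      unfolding \<mu>_def
      by (rule dominant_weight[OF weights_below highest_weight_in_weights[OF lin] val k])
    moreover have "(\<lambda>h. \<mu> h + null_root h) \<notin> weights"
    proof
      assume "(\<lambda>h. \<mu> h + null_root h) \<in> weights"
      from weights_below[OF this] obtain d :: "nat \<Rightarrow> nat"
        where d: "(\<lambda>h. \<mu> h + null_root h) = (\<lambda>h. \<Lambda> h - root_sum (\<lambda>j. int (d j)) h)" ..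
      have "root_sum (\<lambda>j. int (c j) - int (mark X n j)) h = root_sum (\<lambda>j. int (d j)) h" for h
        using fun_cong[OF d, of h] by (simp add: root_sum_diff \<mu>_def null_root_eq_root_sum algebra_simps)
      from root_sum_inject[OF ext[OF this]]
      have "int (c i) - int (mark X n i) = int (d i)" if "i \<le> n" for i
        using that by blast
      then have "0 \<le> int (c i) - int (mark X n i)" if "i \<le> n" for i
        using that by (metis of_nat_0_le_iff)
      \<comment> \<open>Adding the null root lowers the coefficients by the marks, which raises s by
        one.\<close>
      then have "Q (Suc s)"
        unfolding Q_def using c by (simp add: algebra_simps)
      with s(2) show False by force
    qed
    moreover have "\<forall>j\<le>n. \<mu> (coroot j) = of_nat (m j)"
      unfolding \<mu>_def using val by blast
    ultimately show ?thesis
      unfolding maximal_weights_def by blast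
  qed
  then obtain \<mu> where \<mu>: "\<mu> \<in> maximal_weights" "\<And>j. j \<le> n \<Longrightarrow> \<mu> (coroot j) = of_nat (m j)" by blast
  then have "dominant_integral \<mu>"
    by (auto simp: dominant_integral_def maximal_weights_def weights_def)
  moreover have "coroot_values \<mu> = m"
    using \<mu>(2) m(1) by (auto simp: coroot_values_def fun_eq_iff)
  ultimately show ?thesis
    using \<mu>(1) unfolding dominant_maximal_weights_def by blast
qed

lemma bij_betw_coroot_values:
  "bij_betw coroot_values dominant_maximal_weights
    {m. (\<forall>j>n. m j = 0) \<and> (\<Sum>j\<le>n. comark X n j * m j) = l \<and>
        even (class_index X n (\<lambda>j. int (m j) - L j))}"
  unfolding bij_betw_def
proof (intro conjI inj_on_coroot_values equalityI image_subsetI subsetI CollectI)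
  fix m
  assume "m \<in> {m. (\<forall>j>n. m j = 0) \<and> (\<Sum>j\<le>n. comark X n j * m j) = l \<and>
      even (class_index X n (\<lambda>j. int (m j) - L j))}"
  then have "\<exists>\<mu>\<in>dominant_maximal_weights. coroot_values \<mu> = m"
    by (elim CollectE conjE) (rule coroot_values_surj)
  then show "m \<in> coroot_values ` dominant_maximal_weights"
    by auto
qed (drule coroot_values_mem, elim conjE, assumption)+

end

end

theorem corollary6p4:
  fixes hscale :: "complex \<Rightarrow> 'h::ab_group_add \<Rightarrow> 'h"
    and X :: affine_type
    and n :: nat
    and coroot :: "nat \<Rightarrow> 'h"
    and simple_root :: "nat \<Rightarrow> 'h \<Rightarrow> complex"
    and gscale :: "complex \<Rightarrow> 'g::ab_group_add \<Rightarrow> 'g"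
    and bracket :: "'g \<Rightarrow> 'g \<Rightarrow> 'g"
    and cart :: "'h \<Rightarrow> 'g"
    and e f :: "nat \<Rightarrow> 'g"
    and vscale :: "complex \<Rightarrow> 'v::ab_group_add \<Rightarrow> 'v"
    and act :: "'g \<Rightarrow> 'v \<Rightarrow> 'v"
    and \<Lambda> :: "'h \<Rightarrow> complex"
    and \<omega> :: "nat \<Rightarrow> 'h \<Rightarrow> complex"
    and l i :: nat
  assumes module: "irreducible_highest_weight_module hscale X n coroot simple_root
                     gscale bracket cart e f vscale act \<Lambda>"
    and fundamental: "affine_realization.fundamental_weights hscale n coroot \<omega>"
    and index: "i \<in> distinguished X n" "i \<noteq> 0 \<Longrightarrow> l \<ge> 1"
    and \<Lambda>: "\<Lambda> = (\<lambda>h. (of_nat l - 1) * \<omega> 0 h + \<omega> i h)"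
  defines "M \<equiv> affine_module.dominant_maximal_weights hscale X n coroot simple_root cart vscale act"
    and "d \<equiv> (if i = n then 1 else 0 :: int)"
  shows "finite M \<and>
    (X = AffB \<longrightarrow>
      card M = (nat (int n + (int l - d) div 2) choose n)
             + (nat (int n + (int l - 1 - d) div 2) choose n)) \<and>
    (X = AffC \<longrightarrow>
      real (card M) = 1 / 2 * (real ((n + l) choose n)
        + (-1) ^ i * (if even (n * l) then 1 else 0) * real (((n + l) div 2) choose (n div 2)))) \<and>
    (X = TwA \<longrightarrow> card M = ((n + l div 2) choose n)) \<and>
    (X = TwD \<longrightarrow> card M = (nat (int n + (int l - d) div 2) choose n))"
proof -
  interpret irreducible_highest_weight_module hscale X n coroot simple_root
    gscale bracket cart e f vscale act \<Lambda>
    by (rule module)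
  have i: "i \<le> n" and n: "n \<ge> 1" "X = AffC \<Longrightarrow> i \<noteq> n"
    using index(1) rank by (cases X; auto)+
  have \<omega>: "Vector_Spaces.linear hscale (*) (\<omega> j)" "\<omega> j (coroot k) = (if j = k then 1 else 0)"
    if "j \<le> n" "k \<le> n" for j k
    using fundamental that by (auto simp: fundamental_weights_def)
  have bij: "bij_betw coroot_values M (level_class X n l i)"
    unfolding M_def level_class_def
  proof (rule bij_betw_coroot_values)
    show "Vector_Spaces.linear hscale (*) \<Lambda>"
      using \<omega>(1)[of 0] \<omega>(1)[of i] i by (simp add: \<Lambda> linear_dual_iff algebra_simps)
    show "\<Lambda> (coroot j) = of_int (distinguished_label l i j)" if "j \<le> n" for j
      using \<omega>(2)[of 0 j] \<omega>(2)[of i j] that i by (auto simp: \<Lambda> distinguished_label_def)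
    show "(\<Sum>j\<le>n. int (comark X n j) * distinguished_label l i j) = int l"
    proof -
      have one: "comark X n 0 = 1" "comark X n i = 1"
        using index(1) rank by (cases X; auto)+
      have "(\<Sum>j\<le>n. int (comark X n j) * distinguished_label l i j) =
          (\<Sum>j\<le>n. if j = 0 then int (comark X n 0) * (int l - 1) else 0) +
          (\<Sum>j\<le>n. if j = i then int (comark X n i) else 0)"
        unfolding sum.distrib[symmetric] by (intro sum.cong) (auto simp: distinguished_label_def algebra_simps)
      also have "\<dots> = int l"
        using i unfolding one by simp
      finally show ?thesis .
    qed
    show "distinguished_label l i j = 0" if "l = 0" "j \<le> n" for j
      using that index(2) by (auto simp: distinguished_label_def)
  qed
  have card: "card M = card (level_class X n l i)" and fin: "finite M \<longleftrightarrow> finite (level_class X n l i)"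
    using bij_betw_same_card[OF bij] bij_betw_finite[OF bij] by auto
  \<comment> \<open>If i = n then i is nonzero and l is at least 1, so the natural subtraction
    \<open>l - d'\<close> is exact.\<close>
  define d' where "d' = nat d"
  have d': "d' = (if i = n then 1 else 0)" "d' \<le> l" "d = int d'"
    using index(2) n(1) by (auto simp: d'_def d_def)
  have nat_div: "nat (int n + (int l - d) div 2) = n + (l - d') div 2"
  proof -
    have "(int l - d) div 2 = int ((l - d') div 2)"
      using d' by (simp add: zdiv_int of_nat_diff)
    then show ?thesis by simp
  qed
  show ?thesis
  proof (cases X)
    case AffB
    have "nat (int n + (int l - 1 - d) div 2) choose n = (if d' < l then (n + (l - 1 - d') div 2) choose n else 0)"
    proof (cases "d' < l")
      case True
      then have "(int l - 1 - d) div 2 = int ((l - 1 - d') div 2)"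
        using d' by (simp add: zdiv_int of_nat_diff)
      with True show ?thesis by (simp add: nat_int_add)
    next
      case False
      \<comment> \<open>Division rounds down: -1 div 2 = -1, and \<open>n - 1\<close> choose
        \<open>n\<close> is 0, which matches the empty second class.\<close>
      with d' have "int l - 1 - d = -1" by simp
      then have "nat (int n + (int l - 1 - d) div 2) = n - 1" by simp
      with False n(1) show ?thesis by simp
    qed
    then show ?thesis
      using card_level_class_AffB[of n i d' l] AffB rank index(1) d' card fin nat_div by simp
  next
    case AffC
    then have *: "finite (level_class AffC n l i)"
      "2 * int (card (level_class AffC n l i)) = int ((n + l) choose n) +
        (-1) ^ i * (if even (n * l) then int (((n + l) div 2) choose (n div 2)) else 0)"
      using card_level_class_AffC[of n i l] rank index(1) by simp_all
    from *(2) have "real_of_int (2 * int (card (level_class AffC n l i))) = real_of_int (int ((n + l) choose n) +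
        (-1) ^ i * (if even (n * l) then int (((n + l) div 2) choose (n div 2)) else 0))"
      by (simp only:)
    then have "2 * real (card M) = real ((n + l) choose n)
        + (-1) ^ i * (if even (n * l) then 1 else 0) * real (((n + l) div 2) choose (n div 2))"
      unfolding card AffC by (simp split: if_splits)
    then show ?thesis
      using *(1) AffC fin by simp
  next
    case TwA
    then show ?thesis
      using card_level_class_TwA[of n l] rank index(1) card fin by simp
  next
    case TwD
    then show ?thesis
      using card_level_class_TwD[of n i d' l] rank index(1) d' card fin nat_div by simp
  qed
qed

end
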